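(* Let $q$ be a prime power, $n\ge 1$ an integer, and $G=\mathrm{Gal}(\mathbb{F}_{q^n}/\mathbb{F}_q)$. Assume that $\alpha\in\mathbb{F}_{q^n}$ is a generator of a normal basis of $\mathbb{F}_{q^n}$ over $\mathbb{F}_q$ and let $$R=\sum_{g\in G}\mathrm{Tr}\big(\alpha g(\alpha)\big)\,g\ \in\ \mathbb{F}_q[G].$$ Then any $v\in\mathbb{F}_q[G]$ such that $v\overline{v}=R$ is invertible in $\mathbb{F}_q[G]$, and the map $v\mapsto v^{-1}\circ\alpha$ is a one-to-one correspondence between the set of solutions $v\in\mathbb{F}_q[G]$ of the equation $v\overline{v}=R$ and the set of elements of $\mathbb{F}_{q^n}$ that generate a self-dual normal basis of $\mathbb{F}_{q^n}$ over $\mathbb{F}_q$.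
   Context: $G$ is cyclic of order $n$, generated by the Frobenius $\phi:x\mapsto x^q$. $\mathrm{Tr}$ denotes the trace map from $\mathbb{F}_{q^n}$ to $\mathbb{F}_q$. An element $\alpha\in\mathbb{F}_{q^n}$ generates a normal basis if $(\alpha,\alpha^q,\ldots,\alpha^{q^{n-1}})$ is an $\mathbb{F}_q$-basis of $\mathbb{F}_{q^n}$; this normal basis is self-dual if $\mathrm{Tr}(\alpha^{q^i}\alpha^{q^j})=\delta_{i,j}$ (Kronecker delta) for $0\le i,j\le n-1$. Conjugation $u\mapsto\overline{u}$ on the group algebra $\mathbb{F}_q[G]$ is the $\mathbb{F}_q$-algebra automorphism induced by $g\mapsto g^{-1}$ for $g\in G$. For $u=\sum_{k=0}^{n-1}u_k\phi^k\in\mathbb{F}_q[G]$ and $x\in\mathbb{F}_{q^n}$, $u\circ x=\sum_{k=0}^{n-1}u_k\phi^k(x)\in\mathbb{F}_{q^n}$. *)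

theory Defs
  imports
    "HOL-Number_Theory.Prime_Powers"
    "HOL-Algebra.Bij"
    "HOL-Algebra.QuotRing"
    "HOL-Algebra.Embedded_Algebras"
begin

text \<open>
  The extension of finite fields is a field \<open>L\<close> with a subfield \<open>K\<close> of \<open>q\<close> elements.
\<close>

definition galois_group :: "('a, 'b) ring_scheme \<Rightarrow> 'a set \<Rightarrow> ('a \<Rightarrow> 'a) monoid" where
  "galois_group L K =
     (BijGroup (carrier L))
       \<lparr>carrier := {\<sigma> \<in> Bij (carrier L). \<sigma> \<in> ring_hom L L \<and> (\<forall>x\<in>K. \<sigma> x = x)}\<rparr>"

text \<open>
  The group algebra of a \<^emph>\<open>finite\<close> group \<open>G\<close> over \<open>R\<close>: the formal sum of the \<open>u g\<close> times \<open>g\<close>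
  is encoded by its (extensional) coefficient function \<open>u\<close>.
\<close>

definition group_algebra ::
    "('r, 'b) ring_scheme \<Rightarrow> ('g, 'c) monoid_scheme \<Rightarrow> ('g \<Rightarrow> 'r) ring" where
  "group_algebra R G =
     \<lparr>carrier = carrier G \<rightarrow>\<^sub>E carrier R,
      mult = (\<lambda>u v. \<lambda>g\<in>carrier G. \<Oplus>\<^bsub>R\<^esub>h\<in>carrier G. u h \<otimes>\<^bsub>R\<^esub> v (inv\<^bsub>G\<^esub> h \<otimes>\<^bsub>G\<^esub> g)),
      one = (\<lambda>g\<in>carrier G. if g = \<one>\<^bsub>G\<^esub> then \<one>\<^bsub>R\<^esub> else \<zero>\<^bsub>R\<^esub>),
      zero = (\<lambda>g\<in>carrier G. \<zero>\<^bsub>R\<^esub>),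
      add = (\<lambda>u v. \<lambda>g\<in>carrier G. u g \<oplus>\<^bsub>R\<^esub> v g)\<rparr>"

text \<open>The linear extension of \<open>g \<mapsto> inv g\<close>; the coefficient of \<open>g\<close> is the old one of \<open>inv g\<close>.\<close>

definition group_algebra_conj ::
    "('g, 'c) monoid_scheme \<Rightarrow> ('g \<Rightarrow> 'r) \<Rightarrow> ('g \<Rightarrow> 'r)" where
  "group_algebra_conj G u = (\<lambda>g\<in>carrier G. u (inv\<^bsub>G\<^esub> g))"

abbreviation galois_algebra ::
    "('a, 'b) ring_scheme \<Rightarrow> 'a set \<Rightarrow> (('a \<Rightarrow> 'a) \<Rightarrow> 'a) ring" where
  "galois_algebra L K \<equiv> group_algebra (L\<lparr>carrier := K\<rparr>) (galois_group L K)"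

definition galois_action ::
    "('a, 'b) ring_scheme \<Rightarrow> 'a set \<Rightarrow> (('a \<Rightarrow> 'a) \<Rightarrow> 'a) \<Rightarrow> 'a \<Rightarrow> 'a" where
  "galois_action L K u x = (\<Oplus>\<^bsub>L\<^esub>\<sigma>\<in>carrier (galois_group L K). u \<sigma> \<otimes>\<^bsub>L\<^esub> \<sigma> x)"

text \<open>The trace from a field with \<open>q ^ n\<close> elements to its subfield with \<open>q\<close> elements.\<close>

definition field_trace :: "('a, 'b) ring_scheme \<Rightarrow> nat \<Rightarrow> nat \<Rightarrow> 'a \<Rightarrow> 'a" where
  "field_trace L q n x = (\<Oplus>\<^bsub>L\<^esub>i\<in>{..<n}. x [^]\<^bsub>L\<^esub> (q ^ i))"

definition generates_normal_basis ::
    "('a, 'b) ring_scheme \<Rightarrow> 'a set \<Rightarrow> nat \<Rightarrow> nat \<Rightarrow> 'a \<Rightarrow> bool" where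
  "generates_normal_basis L K q n \<alpha> \<longleftrightarrow>
     \<alpha> \<in> carrier L \<and>
     ring.independent L K (map (\<lambda>i. \<alpha> [^]\<^bsub>L\<^esub> (q ^ i)) [0..<n]) \<and>
     ring.Span L K (map (\<lambda>i. \<alpha> [^]\<^bsub>L\<^esub> (q ^ i)) [0..<n]) = carrier L"

definition generates_self_dual_normal_basis ::
    "('a, 'b) ring_scheme \<Rightarrow> 'a set \<Rightarrow> nat \<Rightarrow> nat \<Rightarrow> 'a \<Rightarrow> bool" where
  "generates_self_dual_normal_basis L K q n \<alpha> \<longleftrightarrow>
     generates_normal_basis L K q n \<alpha> \<and>
     (\<forall>i<n. \<forall>j<n. field_trace L q n (\<alpha> [^]\<^bsub>L\<^esub> (q ^ i) \<otimes>\<^bsub>L\<^esub> \<alpha> [^]\<^bsub>L\<^esub> (q ^ j))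
        = (if i = j then \<one>\<^bsub>L\<^esub> else \<zero>\<^bsub>L\<^esub>))"

definition trace_element ::
    "('a, 'b) ring_scheme \<Rightarrow> 'a set \<Rightarrow> nat \<Rightarrow> nat \<Rightarrow> 'a \<Rightarrow> (('a \<Rightarrow> 'a) \<Rightarrow> 'a)" where
  "trace_element L K q n \<alpha> =
     (\<lambda>\<sigma>\<in>carrier (galois_group L K). field_trace L q n (\<alpha> \<otimes>\<^bsub>L\<^esub> \<sigma> \<alpha>))"

definition trace_equation_solutions ::
    "('a, 'b) ring_scheme \<Rightarrow> 'a set \<Rightarrow> nat \<Rightarrow> nat \<Rightarrow> 'a \<Rightarrow> (('a \<Rightarrow> 'a) \<Rightarrow> 'a) set" where
  "trace_equation_solutions L K q n \<alpha> =
     {v \<in> carrier (galois_algebra L K).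
        v \<otimes>\<^bsub>galois_algebra L K\<^esub> group_algebra_conj (galois_group L K) v
          = trace_element L K q n \<alpha>}"

end

theory Submission
  imports Defs "HOL-Algebra.Multiplicative_Group"
begin

text \<open>
  Put \<open>\<langle>x, y\<rangle> = \<Sum>\<sigma>. Tr (x \<sigma>(y)) \<sigma>\<close>. This form on \<open>L\<close> is Hermitian over the commutative algebra
  \<open>K[G]\<close>, so \<open>\<langle>u \<circ> \<alpha>, u \<circ> \<alpha>\<rangle> = u u* R\<close> with \<open>R = \<langle>\<alpha>, \<alpha>\<rangle>\<close> and \<open>u*\<close> the conjugate of \<open>u\<close>.
  As \<open>\<alpha>\<close> is normal, \<open>L\<close> is free of rank one on \<open>\<alpha>\<close>, and \<open>\<beta> = u \<circ> \<alpha>\<close> is self-dual normal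
  iff \<open>u u* R = 1\<close>, that is, iff \<open>u\<close> is the inverse of a solution of \<open>v v* = R\<close>. Solutions are
  invertible because the trace form is nondegenerate, hence multiplication by \<open>R\<close>, and a
  fortiori by \<open>v\<close>, is injective on the finite set \<open>K[G]\<close>.

  That every automorphism is a power of Frobenius follows from the normal basis too: \<open>\<sigma>\<close> agrees
  on \<open>\<alpha>\<close>, hence everywhere, with a \<open>K\<close>-combination of powers of Frobenius, and Dedekind's
  independence theorem forces \<open>\<sigma>\<close> to be one of these powers.
\<close>

section \<open>Frobenius and bases of finite fields\<close>

text \<open>Induction on \<open>n\<close>: multiplying the sum by \<open>x\<close> and by
  \<open>y\<close> gives two sums whose coefficients combine by Pascal's rule. The coefficients are
  natural multiples in the ring, so that divisibility by a prime can later make them vanish.\<close>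

lemma (in cring) binomial_expansion:
  assumes "x \<in> carrier R" "y \<in> carrier R"
  shows "(x \<oplus> y) [^] (n::nat) = (\<Oplus>k\<in>{..n}. [(n choose k)] \<cdot> (x [^] k \<otimes> y [^] (n - k)))"
proof (induction n)
  case 0
  then show ?case by (simp add: assms)
next
  case (Suc n)
  define z where "z k = x [^] Suc k \<otimes> y [^] (n - k)" for k :: nat
  have z: "z k \<in> carrier R" for k using assms by (simp add: z_def)
  let ?S = "\<Oplus>k\<in>{..n}. [(n choose k)] \<cdot> (x [^] k \<otimes> y [^] (n - k))"
  have S: "?S \<in> carrier R" using assms by (intro finsum_closed) auto
  have Sx: "?S \<otimes> x = (\<Oplus>k\<in>{..n}. [(n choose k)] \<cdot> z k)"
    using assms
    by (subst finsum_ldistr) (auto simp: add_pow_ldistr add_pow_rdistr z_def m_ac intro!: finsum_cong')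
  have "?S \<otimes> y = (\<Oplus>k\<in>{..n}. [(n choose k)] \<cdot> (x [^] k \<otimes> y [^] (Suc n - k)))"
    using assms
    by (subst finsum_ldistr) (auto simp: add_pow_ldistr add_pow_rdistr Suc_diff_le m_ac intro!: finsum_cong')
  \<comment> \<open>The extra term at \<open>Suc n\<close> is zero because its binomial coefficient
    vanishes. With it, the term at 0 can be split off and the rest shifted by one to match the
    indices of \<open>Sx\<close>.\<close>
  also have "\<dots> = (\<Oplus>k\<in>{..Suc n}. [(n choose k)] \<cdot> (x [^] k \<otimes> y [^] (Suc n - k)))"
    using assms by (subst finsum_Suc) (auto simp: binomial_eq_0 intro!: finsum_closed l_zero[symmetric])
  also have "\<dots> = (\<Oplus>k\<in>{..n}. [(n choose Suc k)] \<cdot> z k) \<oplus> y [^] Suc n"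
    using assms by (subst finsum_Suc2) (auto simp: z_def)
  finally have Sy: "?S \<otimes> y = (\<Oplus>k\<in>{..n}. [(n choose Suc k)] \<cdot> z k) \<oplus> y [^] Suc n" .
  have "(x \<oplus> y) [^] Suc n = ?S \<otimes> x \<oplus> ?S \<otimes> y"
    using assms S by (simp add: Suc r_distr)
  also have "\<dots> = (\<Oplus>k\<in>{..n}. [(n choose k)] \<cdot> z k) \<oplus> (\<Oplus>k\<in>{..n}. [(n choose Suc k)] \<cdot> z k) \<oplus> y [^] Suc n"
    unfolding Sx Sy using assms z by (intro a_assoc[symmetric] finsum_closed) auto
  also have "(\<Oplus>k\<in>{..n}. [(n choose k)] \<cdot> z k) \<oplus> (\<Oplus>k\<in>{..n}. [(n choose Suc k)] \<cdot> z k)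
    = (\<Oplus>k\<in>{..n}. [(Suc n choose Suc k)] \<cdot> z k)"
    using z by (subst finsum_addf[symmetric]) (auto simp: add.nat_pow_mult intro!: finsum_cong')
  also have "\<dots> \<oplus> y [^] Suc n = (\<Oplus>k\<in>{..Suc n}. [(Suc n choose k)] \<cdot> (x [^] k \<otimes> y [^] (Suc n - k)))"
    using assms by (subst finsum_Suc2) (auto simp: z_def)
  finally show ?case .
qed

text \<open>A prime \<open>p\<close> divides every inner binomial coefficient, so only the two outer
  terms of the \<open>p\<close>-th power survive in characteristic \<open>p\<close>. Iterating this
  \<open>k\<close> times gives the exponent \<open>p ^ k\<close>.\<close>

lemma (in cring) prime_power_add:
  assumes p: "prime p" "[p] \<cdot> \<one> = \<zero>" and xy: "x \<in> carrier R" "y \<in> carrier R"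
  shows "(x \<oplus> y) [^] (p ^ k :: nat) = x [^] (p ^ k) \<oplus> y [^] (p ^ k)"
  using xy
proof (induction k arbitrary: x y)
  case 0
  then show ?case by simp
next
  case (Suc k)
  have p_zero: "[p] \<cdot> z = \<zero>" if "z \<in> carrier R" for z
    using add_pow_ldistr[of \<one> z p] that p(2) by simp
  have "(x \<oplus> y) [^] p = x [^] p \<oplus> y [^] p" if xy: "x \<in> carrier R" "y \<in> carrier R" for x y
  proof -
    let ?t = "\<lambda>k. [(p choose k)] \<cdot> (x [^] k \<otimes> y [^] (p - k))"
    have vanish: "?t k = \<zero>" if k: "k \<in> {..p} - {0, p}" for k
    proof -
      have "p dvd p choose k"
        using k p(1) prime_gt_0_nat[OF p(1)] by (intro dvd_choose_prime) auto
      then obtain m where m: "p choose k = p * m" by (elim dvdE)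
      have "[(p * m)] \<cdot> z = [m] \<cdot> ([p] \<cdot> z)" if "z \<in> carrier R" for z
        using that by (simp add: add.nat_pow_pow)
      then show ?thesis using xy by (simp add: m p_zero)
    qed
    have "p \<noteq> 0" using prime_gt_0_nat[OF p(1)] by simp
    have "(x \<oplus> y) [^] p = (\<Oplus>k\<in>{..p}. ?t k)" by (rule binomial_expansion[OF xy])
    also have "\<dots> = (\<Oplus>k\<in>{0, p}. ?t k)"
      using vanish xy by (intro add.finprod_mono_neutral_cong_right) auto
    also have "\<dots> = x [^] p \<oplus> y [^] p"
      using xy \<open>p \<noteq> 0\<close> by (simp add: a_comm)
    finally show ?thesis .
  qed
  then have "(x \<oplus> y) [^] (p ^ Suc k) = (x [^] p \<oplus> y [^] p) [^] (p ^ k)"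
    using Suc.prems by (simp add: nat_pow_pow[symmetric])
  also have "\<dots> = x [^] (p ^ Suc k) \<oplus> y [^] (p ^ Suc k)"
    using Suc.prems by (simp add: Suc.IH nat_pow_pow)
  finally show ?case .
qed

text \<open>Lagrange's theorem in the additive group kills the multiple \<open>p ^ k\<close> of one.
  That multiple is the \<open>k\<close>-th power of the multiple \<open>p\<close> of one, and a
  domain has no nonzero nilpotent elements.\<close>

lemma (in domain) char_of_prime_power_card:
  assumes "card (carrier R) = p ^ k" "finite (carrier R)"
  shows "[p] \<cdot> \<one> = \<zero>"
proof -
  have one: "[p] \<cdot> \<one> \<in> carrier R" by simp
  have pow: "[(p ^ k)] \<cdot> \<one> = ([p] \<cdot> \<one>) [^] k" for k :: nat
  proof (induction k)
    case (Suc k)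
    have "[(p ^ Suc k)] \<cdot> \<one> = [p] \<cdot> ([(p ^ k)] \<cdot> \<one>)"
      by (simp add: add.nat_pow_pow mult.commute)
    also have "\<dots> = ([(p ^ k)] \<cdot> \<one>) \<otimes> ([p] \<cdot> \<one>)"
      using add_pow_rdistr[of "[(p ^ k)] \<cdot> \<one>" \<one> p] by simp
    finally show ?case by (simp add: Suc)
  qed simp
  have "[(p ^ k)] \<cdot> \<one> = \<zero>"
    using add.pow_order_eq_1[of \<one>] assms by (simp add: order_def)
  then have "([p] \<cdot> \<one>) [^] k = \<zero>" by (simp add: pow)
  then show ?thesis
  proof (induction k)
    case (Suc k)
    then show ?case using integral_iff[of "([p] \<cdot> \<one>) [^] k" "[p] \<cdot> \<one>"] by auto
  qed simp
qed

text \<open>Lagrange's theorem in the multiplicative group handles nonzero \<open>x\<close>; at zero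
  it matters that the exponent is positive.\<close>

lemma (in field) pow_card_eq:
  assumes "finite (carrier R)" "x \<in> carrier R"
  shows "x [^] card (carrier R) = x"
proof (cases "x = \<zero>")
  case True
  have "card (carrier R) \<noteq> 0" using assms by auto
  then show ?thesis using True by (simp add: nat_pow_zero)
next
  case False
  interpret M: group "mult_of R" by (rule field_mult_group)
  have "x [^] (card (carrier R) - 1) = \<one>"
    using M.pow_order_eq_1[of x] assms False order_mult_of[OF assms(1)]
    by (simp add: nat_pow_mult_of order_def)
  then have "x [^] Suc (card (carrier R) - 1) = x"
    using assms by simp
  moreover have "card (carrier R) > 0" using assms by (auto simp: card_gt_0_iff)
  ultimately show ?thesis by simp
qed

section \<open>Bases as bijective coordinate maps\<close>

lemma (in ring) combine_map_eq_finsum: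
  assumes "distinct is" "c \<in> set is \<rightarrow> carrier R" "b \<in> set is \<rightarrow> carrier R"
  shows "combine (map c is) (map b is) = (\<Oplus>i\<in>set is. c i \<otimes> b i)"
  using assms by (induction "is") (auto simp: Pi_def)

text \<open>Independence is injectivity of the coordinate map and spanning is its surjectivity. This
  trades lists of vectors and scalars for extensional coefficient functions, the encoding also used
  for the group algebra.\<close>

lemma (in ring) basis_iff_bij_betw:
  assumes K: "subfield K R" and b: "b \<in> {..<n} \<rightarrow> carrier R"
  shows "independent K (map b [0..<n]) \<and> Span K (map b [0..<n]) = carrier R \<longleftrightarrow>
    bij_betw (\<lambda>c. \<Oplus>i\<in>{..<n}. c i \<otimes> b i) ({..<n} \<rightarrow>\<^sub>E K) (carrier R)"
proof -
  let ?U = "map b [0..<n]" and ?f = "\<lambda>c. \<Oplus>i\<in>{..<n}. c i \<otimes> b i"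
  have sub: "K \<subseteq> carrier R" by (rule subfieldE(3)[OF K])
  have U: "set ?U \<subseteq> carrier R" using b by auto
  have comb: "combine (map c [0..<n]) ?U = ?f c" if "c \<in> {..<n} \<rightarrow> carrier R" for c
    using combine_map_eq_finsum[of "[0..<n]" c b] that b by (simp add: atLeast0LessThan)
  have ex_fun: "\<exists>c\<in>{..<n} \<rightarrow>\<^sub>E K. Ks = map c [0..<n]" if "set Ks \<subseteq> K" "length Ks = n" for Ks
  proof
    show "(\<lambda>i\<in>{..<n}. Ks ! i) \<in> {..<n} \<rightarrow>\<^sub>E K" using that by auto
    show "Ks = map (\<lambda>i\<in>{..<n}. Ks ! i) [0..<n]" using that by (auto intro: nth_equalityI)
  qed
  have closed: "c \<in> {..<n} \<rightarrow> carrier R" if "c \<in> {..<n} \<rightarrow>\<^sub>E K" for c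
    using that sub by auto
  have span: "Span K ?U = ?f ` ({..<n} \<rightarrow>\<^sub>E K)"
  proof (intro equalityI subsetI)
    fix x assume "x \<in> Span K ?U"
    then obtain Ks where Ks: "x = combine Ks ?U" "length Ks = n" "set Ks \<subseteq> K"
      by (auto simp: Span_eq_combine_set_length_version[OF K U] simp del: Span.simps)
    obtain c where c: "c \<in> {..<n} \<rightarrow>\<^sub>E K" "Ks = map c [0..<n]"
      using ex_fun[OF Ks(3,2)] by blast
    then have "x = ?f c" by (simp only: Ks(1) comb[OF closed[OF c(1)]])
    then show "x \<in> ?f ` ({..<n} \<rightarrow>\<^sub>E K)" using c(1) by (rule image_eqI)
  next
    fix x assume "x \<in> ?f ` ({..<n} \<rightarrow>\<^sub>E K)"
    then obtain c where c: "x = ?f c" "c \<in> {..<n} \<rightarrow>\<^sub>E K" by (rule imageE)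
    have "x = combine (map c [0..<n]) ?U" by (rule trans[OF c(1) comb[OF closed[OF c(2)], symmetric]])
    moreover have "set (map c [0..<n]) \<subseteq> K"
      using PiE_mem[OF c(2)] by (simp add: image_subset_iff)
    ultimately have "\<exists>Ks. x = combine Ks ?U \<and> length Ks = length ?U \<and> set Ks \<subseteq> K"
      by (intro exI[of _ "map c [0..<n]"] conjI) simp_all
    then show "x \<in> Span K ?U"
      unfolding Span_eq_combine_set_length_version[OF K U] by blast
  qed
  have "independent K ?U \<longleftrightarrow> inj_on ?f ({..<n} \<rightarrow>\<^sub>E K)"
  proof
    assume ind: "independent K ?U"
    show "inj_on ?f ({..<n} \<rightarrow>\<^sub>E K)"
    proof (rule inj_onI)
      fix c d assume c: "c \<in> {..<n} \<rightarrow>\<^sub>E K" and d: "d \<in> {..<n} \<rightarrow>\<^sub>E K" and eq: "?f c = ?f d"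
      define e where "e i = c i \<ominus> d i" for i
      note cd = closed[OF c] closed[OF d]
      have eK: "e i \<in> K" if "i < n" for i
        using PiE_mem[OF c, of i] PiE_mem[OF d, of i] that subringE(5,7)[OF subfieldE(1)[OF K]]
        by (simp add: e_def a_minus_def)
      have eR: "e \<in> {..<n} \<rightarrow> carrier R" using eK sub by auto
      have ced: "c i = e i \<oplus> d i" if "i < n" for i
        using that cd by (auto simp: e_def a_minus_def a_assoc l_neg Pi_def)
      have "?f c = (\<Oplus>i\<in>{..<n}. e i \<otimes> b i \<oplus> d i \<otimes> b i)"
        using eR cd b by (intro finsum_cong') (auto simp: ced l_distr Pi_def)
      also have "\<dots> = ?f e \<oplus> ?f d"
        using eR cd b by (intro finsum_addf) (auto simp: Pi_def)
      finally have "?f d = ?f e \<oplus> ?f d" by (simp only: eq)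
      moreover have "?f e \<in> carrier R" "?f d \<in> carrier R"
        using eR cd b by (auto intro!: finsum_closed simp: Pi_def)
      ultimately have "?f e = \<zero>" by (metis add.r_cancel_one')
      then have "combine (map e [0..<n]) ?U = \<zero>" by (simp add: comb eR)
      moreover have "set (map e [0..<n]) \<subseteq> K" using eK by auto
      ultimately have "set (take (length ?U) (map e [0..<n])) \<subseteq> {\<zero>}"
        by (intro independent_imp_trivial_combine[OF K ind])
      then have "e i = \<zero>" if "i < n" for i using that by (simp add: image_subset_iff)
      then have "c i = d i" if "i < n" for i
        using ced[OF that] that cd by (auto simp: Pi_def)
      then show "c = d" using c d by (intro PiE_ext) auto
    qed
  next
    assume inj: "inj_on ?f ({..<n} \<rightarrow>\<^sub>E K)"
    show "independent K ?U"
    proof (rule trivial_combine_imp_independent[OF K U])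
      fix Ks assume Ks: "set Ks \<subseteq> K" "combine Ks ?U = \<zero>"
      from Ks(1) sub have "set Ks \<subseteq> carrier R" by blast
      \<comment> \<open>A vanishing combination may come with a scalar list of any length. It is cut
        or padded with zeros to length \<open>n\<close>, so that it becomes a coordinate
        vector.\<close>
      then obtain Ks' where Ks': "set (take (length ?U) Ks) \<subseteq> set Ks'"
        "set Ks' \<subseteq> set (take (length ?U) Ks) \<union> {\<zero>}" "length Ks' = length ?U" "combine Ks' ?U = \<zero>"
        using combine_normalize[OF _ U Ks(2)] by metis
      have zero: "\<zero> \<in> K" by (rule subringE(2)[OF subfieldE(1)[OF K]])
      have Ks'_K: "set Ks' \<subseteq> K" using Ks'(2) Ks(1) zero set_take_subset[of "length ?U" Ks] by blast
      have "length Ks' = n" using Ks'(3) by simp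
      from ex_fun[OF Ks'_K this]
      obtain c where c: "c \<in> {..<n} \<rightarrow>\<^sub>E K" "Ks' = map c [0..<n]" by blast
      have z: "(\<lambda>i\<in>{..<n}. \<zero>) \<in> {..<n} \<rightarrow>\<^sub>E K" using zero by simp
      have "?f c = \<zero>" using Ks'(4) by (simp only: c(2) comb[OF closed[OF c(1)]])
      also have "\<zero> = ?f (\<lambda>i\<in>{..<n}. \<zero>)"
        using b by (intro add.finprod_one_eqI[symmetric]) (auto simp: Pi_def)
      finally have "c = (\<lambda>i\<in>{..<n}. \<zero>)"
        by (rule inj_onD[OF inj _ c(1) z])
      then have "set Ks' \<subseteq> {\<zero>}" unfolding c(2) by (simp add: image_subset_iff)
      then show "set (take (length ?U) Ks) \<subseteq> {\<zero>}" using Ks'(1) by blast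
    qed
  qed
  then show ?thesis
    unfolding bij_betw_def span by blast
qed

section \<open>The group algebra of a finite commutative group\<close>

lemma (in abelian_monoid) finsum_swap:
  assumes "finite A" "finite B" "\<And>a b. a \<in> A \<Longrightarrow> b \<in> B \<Longrightarrow> f a b \<in> carrier G"
  shows "(\<Oplus>a\<in>A. \<Oplus>b\<in>B. f a b) = (\<Oplus>b\<in>B. \<Oplus>a\<in>A. f a b)"
  using assms(1,3)
proof (induction A rule: finite_induct)
  case (insert x F)
  have "(\<Oplus>a\<in>insert x F. \<Oplus>b\<in>B. f a b) = (\<Oplus>b\<in>B. f x b) \<oplus> (\<Oplus>b\<in>B. \<Oplus>a\<in>F. f a b)"
    using insert by (subst finsum_insert) (auto intro!: finsum_closed)
  also have "\<dots> = (\<Oplus>b\<in>B. f x b \<oplus> (\<Oplus>a\<in>F. f a b))"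
    using insert by (subst finsum_addf) (auto intro!: finsum_closed)
  also have "\<dots> = (\<Oplus>b\<in>B. \<Oplus>a\<in>insert x F. f a b)"
    using insert by (intro finsum_cong') (auto intro!: finsum_closed)
  finally show ?case .
qed simp

lemma (in abelian_monoid) finsum_reindex_bij:
  assumes "bij_betw h A B" "f \<in> B \<rightarrow> carrier G"
  shows "(\<Oplus>b\<in>B. f b) = (\<Oplus>a\<in>A. f (h a))"
  using finsum_reindex[of f h A] assms by (auto simp: bij_betw_def)

text \<open>Convolutions in the group algebra are summed in the small ring \<open>K\<close>, whereas
  the action on \<open>L\<close> sums in the large one. This lets both be computed in
  \<open>L\<close>.\<close>

lemma (in ring) subring_finsum_consistent:
  assumes "subring K R" "f \<in> A \<rightarrow> K"
  shows "finsum (R\<lparr>carrier := K\<rparr>) f A = finsum R f A"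
proof -
  interpret K: ring "R\<lparr>carrier := K\<rparr>" by (rule subring_is_ring[OF assms(1)])
  note sub = subringE(1)[OF assms(1)]
  show ?thesis
  proof (cases "finite A")
    case True
    then show ?thesis
      using assms(2)
    proof (induction A rule: finite_induct)
      case empty
      show ?case using K.finsum_empty[of f] finsum_empty[of f] by simp
    next
      case (insert x F)
      have "finsum (R\<lparr>carrier := K\<rparr>) f (insert x F) = f x \<oplus> finsum (R\<lparr>carrier := K\<rparr>) f F"
        using K.finsum_insert[of F x f] insert by simp
      moreover have "finsum R f (insert x F) = f x \<oplus> finsum R f F"
        using insert sub by (intro finsum_insert) auto
      ultimately show ?case using insert by auto
    qed
  next
    case False
    then show ?thesis using K.finsum_infinite[of A f] finsum_infinite[of A f] by simp
  qed
qed

lemma (in group) bij_betw_mult_left: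
  assumes "a \<in> carrier G"
  shows "bij_betw (\<lambda>x. a \<otimes> x) (carrier G) (carrier G)"
  using assms by (auto simp: bij_betw_def inj_on_cmult surj_const_mult)

lemma (in group) bij_betw_inv: "bij_betw (\<lambda>x. inv x) (carrier G) (carrier G)"
  by (rule bij_betw_byWitness[where f' = "\<lambda>x. inv x"]) auto

section \<open>Convolution and conjugation on the group algebra\<close>

locale finite_comm_group_algebra = R: cring R + G: comm_group G
  for R (structure) and G (structure) +
  assumes finite_group: "finite (carrier G)"
begin

abbreviation A where "A \<equiv> group_algebra R G"

lemma coeff_closed: "u \<in> carrier A \<Longrightarrow> g \<in> carrier G \<Longrightarrow> u g \<in> carrier R"
  by (auto simp: group_algebra_def)

lemma algebra_eqI:
  assumes "u \<in> carrier A" "v \<in> carrier A" "\<And>g. g \<in> carrier G \<Longrightarrow> u g = v g"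
  shows "u = v"
  using assms unfolding group_algebra_def by (auto intro: PiE_ext)

lemma mult_coeff:
  "g \<in> carrier G \<Longrightarrow>
    (u \<otimes>\<^bsub>A\<^esub> v) g = (\<Oplus>\<^bsub>R\<^esub>h\<in>carrier G. u h \<otimes>\<^bsub>R\<^esub> v (inv\<^bsub>G\<^esub> h \<otimes>\<^bsub>G\<^esub> g))"
  by (simp add: group_algebra_def)

lemma one_coeff: "g \<in> carrier G \<Longrightarrow> \<one>\<^bsub>A\<^esub> g = (if g = \<one>\<^bsub>G\<^esub> then \<one>\<^bsub>R\<^esub> else \<zero>\<^bsub>R\<^esub>)"
  by (simp add: group_algebra_def)

lemma one_in_algebra: "\<one>\<^bsub>A\<^esub> \<in> carrier A"
  by (auto simp: group_algebra_def)

lemma mult_in_algebra: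
  assumes "u \<in> carrier A" "v \<in> carrier A"
  shows "u \<otimes>\<^bsub>A\<^esub> v \<in> carrier A"
  using assms by (auto simp: group_algebra_def intro!: R.finsum_closed R.m_closed)

lemma conj_in_algebra: "u \<in> carrier A \<Longrightarrow> group_algebra_conj G u \<in> carrier A"
  by (auto simp: group_algebra_def group_algebra_conj_def)

text \<open>After interchanging the two sums, the substitution of \<open>k\<close> times
  \<open>h\<close> for \<open>h\<close> turns the inner sum into a convolution of \<open>v\<close>
  and \<open>w\<close>.\<close>

lemma algebra_m_assoc:
  assumes "u \<in> carrier A" "v \<in> carrier A" "w \<in> carrier A"
  shows "u \<otimes>\<^bsub>A\<^esub> v \<otimes>\<^bsub>A\<^esub> w = u \<otimes>\<^bsub>A\<^esub> (v \<otimes>\<^bsub>A\<^esub> w)"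
proof (rule algebra_eqI)
  fix g assume g: "g \<in> carrier G"
  note c = assms[THEN coeff_closed]
  have "(u \<otimes>\<^bsub>A\<^esub> v \<otimes>\<^bsub>A\<^esub> w) g
    = (\<Oplus>\<^bsub>R\<^esub>h\<in>carrier G. (\<Oplus>\<^bsub>R\<^esub>k\<in>carrier G. u k \<otimes>\<^bsub>R\<^esub> v (inv\<^bsub>G\<^esub> k \<otimes>\<^bsub>G\<^esub> h)) \<otimes>\<^bsub>R\<^esub> w (inv\<^bsub>G\<^esub> h \<otimes>\<^bsub>G\<^esub> g))"
    using g c by (auto simp: mult_coeff cong: R.finsum_cong' intro!: R.finsum_cong' R.finsum_closed)
  also have "\<dots> = (\<Oplus>\<^bsub>R\<^esub>h\<in>carrier G. \<Oplus>\<^bsub>R\<^esub>k\<in>carrier G.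
      u k \<otimes>\<^bsub>R\<^esub> v (inv\<^bsub>G\<^esub> k \<otimes>\<^bsub>G\<^esub> h) \<otimes>\<^bsub>R\<^esub> w (inv\<^bsub>G\<^esub> h \<otimes>\<^bsub>G\<^esub> g))"
    using g c by (intro R.finsum_cong' R.finsum_ldistr) (auto intro!: R.finsum_closed simp: finite_group)
  also have "\<dots> = (\<Oplus>\<^bsub>R\<^esub>k\<in>carrier G. \<Oplus>\<^bsub>R\<^esub>h\<in>carrier G.
      u k \<otimes>\<^bsub>R\<^esub> v (inv\<^bsub>G\<^esub> k \<otimes>\<^bsub>G\<^esub> h) \<otimes>\<^bsub>R\<^esub> w (inv\<^bsub>G\<^esub> h \<otimes>\<^bsub>G\<^esub> g))"
    using g c by (intro R.finsum_swap) (auto simp: finite_group)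
  also have "\<dots> = (\<Oplus>\<^bsub>R\<^esub>k\<in>carrier G. u k \<otimes>\<^bsub>R\<^esub> (v \<otimes>\<^bsub>A\<^esub> w) (inv\<^bsub>G\<^esub> k \<otimes>\<^bsub>G\<^esub> g))"
  proof (intro R.finsum_cong' refl)
    fix k assume k: "k \<in> carrier G"
    have "(\<Oplus>\<^bsub>R\<^esub>h\<in>carrier G. u k \<otimes>\<^bsub>R\<^esub> v (inv\<^bsub>G\<^esub> k \<otimes>\<^bsub>G\<^esub> h) \<otimes>\<^bsub>R\<^esub> w (inv\<^bsub>G\<^esub> h \<otimes>\<^bsub>G\<^esub> g))
      = (\<Oplus>\<^bsub>R\<^esub>h\<in>carrier G. u k \<otimes>\<^bsub>R\<^esub> v (inv\<^bsub>G\<^esub> k \<otimes>\<^bsub>G\<^esub> (k \<otimes>\<^bsub>G\<^esub> h)) \<otimes>\<^bsub>R\<^esub> w (inv\<^bsub>G\<^esub> (k \<otimes>\<^bsub>G\<^esub> h) \<otimes>\<^bsub>G\<^esub> g))"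
      using g c k by (intro R.finsum_reindex_bij G.bij_betw_mult_left) auto
    also have "\<dots> = (\<Oplus>\<^bsub>R\<^esub>h\<in>carrier G. u k \<otimes>\<^bsub>R\<^esub> (v h \<otimes>\<^bsub>R\<^esub> w (inv\<^bsub>G\<^esub> h \<otimes>\<^bsub>G\<^esub> (inv\<^bsub>G\<^esub> k \<otimes>\<^bsub>G\<^esub> g))))"
    proof (intro R.finsum_cong' refl)
      fix h assume h: "h \<in> carrier G"
      have "inv\<^bsub>G\<^esub> k \<otimes>\<^bsub>G\<^esub> (k \<otimes>\<^bsub>G\<^esub> h) = h"
        using k h by (simp flip: G.m_assoc)
      moreover have "inv\<^bsub>G\<^esub> (k \<otimes>\<^bsub>G\<^esub> h) \<otimes>\<^bsub>G\<^esub> g = inv\<^bsub>G\<^esub> h \<otimes>\<^bsub>G\<^esub> (inv\<^bsub>G\<^esub> k \<otimes>\<^bsub>G\<^esub> g)"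
        using k h g by (simp add: G.inv_mult_group G.m_assoc)
      ultimately show "u k \<otimes>\<^bsub>R\<^esub> v (inv\<^bsub>G\<^esub> k \<otimes>\<^bsub>G\<^esub> (k \<otimes>\<^bsub>G\<^esub> h)) \<otimes>\<^bsub>R\<^esub> w (inv\<^bsub>G\<^esub> (k \<otimes>\<^bsub>G\<^esub> h) \<otimes>\<^bsub>G\<^esub> g)
        = u k \<otimes>\<^bsub>R\<^esub> (v h \<otimes>\<^bsub>R\<^esub> w (inv\<^bsub>G\<^esub> h \<otimes>\<^bsub>G\<^esub> (inv\<^bsub>G\<^esub> k \<otimes>\<^bsub>G\<^esub> g)))"
        using k h g c by (simp add: R.m_assoc)
    qed (use g c k in auto)
    also have "\<dots> = u k \<otimes>\<^bsub>R\<^esub> (v \<otimes>\<^bsub>A\<^esub> w) (inv\<^bsub>G\<^esub> k \<otimes>\<^bsub>G\<^esub> g)"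
      using g c k by (subst R.finsum_rdistr[symmetric]) (auto simp: finite_group mult_coeff)
    finally show "(\<Oplus>\<^bsub>R\<^esub>h\<in>carrier G. u k \<otimes>\<^bsub>R\<^esub> v (inv\<^bsub>G\<^esub> k \<otimes>\<^bsub>G\<^esub> h) \<otimes>\<^bsub>R\<^esub> w (inv\<^bsub>G\<^esub> h \<otimes>\<^bsub>G\<^esub> g))
      = u k \<otimes>\<^bsub>R\<^esub> (v \<otimes>\<^bsub>A\<^esub> w) (inv\<^bsub>G\<^esub> k \<otimes>\<^bsub>G\<^esub> g)" .
  qed (auto simp: g c coeff_closed[OF mult_in_algebra[OF assms(2,3)]])
  also have "\<dots> = (u \<otimes>\<^bsub>A\<^esub> (v \<otimes>\<^bsub>A\<^esub> w)) g"
    using g by (simp add: mult_coeff)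
  finally show "(u \<otimes>\<^bsub>A\<^esub> v \<otimes>\<^bsub>A\<^esub> w) g = (u \<otimes>\<^bsub>A\<^esub> (v \<otimes>\<^bsub>A\<^esub> w)) g" .
qed (intro mult_in_algebra assms)+

text \<open>The substitution of \<open>g\<close> times the inverse of \<open>h\<close> for
  \<open>h\<close> exchanges the arguments of \<open>u\<close> and \<open>v\<close>; both the group
  and the ring being commutative, the result is the convolution in the other order.\<close>

lemma algebra_m_comm:
  assumes "u \<in> carrier A" "v \<in> carrier A"
  shows "u \<otimes>\<^bsub>A\<^esub> v = v \<otimes>\<^bsub>A\<^esub> u"
proof (rule algebra_eqI)
  fix g assume g: "g \<in> carrier G"
  note c = assms[THEN coeff_closed]
  have bij: "bij_betw (\<lambda>h. g \<otimes>\<^bsub>G\<^esub> inv\<^bsub>G\<^esub> h) (carrier G) (carrier G)"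
    using bij_betw_trans[OF G.bij_betw_inv G.bij_betw_mult_left[OF g]] by (simp add: comp_def)
  have "(u \<otimes>\<^bsub>A\<^esub> v) g = (\<Oplus>\<^bsub>R\<^esub>h\<in>carrier G. u (g \<otimes>\<^bsub>G\<^esub> inv\<^bsub>G\<^esub> h) \<otimes>\<^bsub>R\<^esub> v (inv\<^bsub>G\<^esub> (g \<otimes>\<^bsub>G\<^esub> inv\<^bsub>G\<^esub> h) \<otimes>\<^bsub>G\<^esub> g))"
    unfolding mult_coeff[OF g] using g c by (intro R.finsum_reindex_bij[OF bij]) auto
  also have "\<dots> = (v \<otimes>\<^bsub>A\<^esub> u) g"
    unfolding mult_coeff[OF g]
  proof (intro R.finsum_cong' refl)
    fix h assume h: "h \<in> carrier G"
    have "inv\<^bsub>G\<^esub> (g \<otimes>\<^bsub>G\<^esub> inv\<^bsub>G\<^esub> h) \<otimes>\<^bsub>G\<^esub> g = h"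
      using g h by (simp add: G.inv_mult_group G.m_assoc)
    then show "u (g \<otimes>\<^bsub>G\<^esub> inv\<^bsub>G\<^esub> h) \<otimes>\<^bsub>R\<^esub> v (inv\<^bsub>G\<^esub> (g \<otimes>\<^bsub>G\<^esub> inv\<^bsub>G\<^esub> h) \<otimes>\<^bsub>G\<^esub> g)
      = v h \<otimes>\<^bsub>R\<^esub> u (inv\<^bsub>G\<^esub> h \<otimes>\<^bsub>G\<^esub> g)"
      using g h c by (simp add: R.m_comm G.m_comm)
  qed (use g c in auto)
  finally show "(u \<otimes>\<^bsub>A\<^esub> v) g = (v \<otimes>\<^bsub>A\<^esub> u) g" .
qed (intro mult_in_algebra assms)+

lemma algebra_l_one:
  assumes "u \<in> carrier A"
  shows "\<one>\<^bsub>A\<^esub> \<otimes>\<^bsub>A\<^esub> u = u"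
proof (rule algebra_eqI)
  fix g assume g: "g \<in> carrier G"
  note c = coeff_closed[OF assms]
  have "(\<one>\<^bsub>A\<^esub> \<otimes>\<^bsub>A\<^esub> u) g
    = (\<Oplus>\<^bsub>R\<^esub>h\<in>carrier G. if \<one>\<^bsub>G\<^esub> = h then u (inv\<^bsub>G\<^esub> h \<otimes>\<^bsub>G\<^esub> g) else \<zero>\<^bsub>R\<^esub>)"
    unfolding mult_coeff[OF g] using g c by (intro R.finsum_cong') (auto simp: one_coeff)
  also have "\<dots> = u g"
    using g c by (subst R.finsum_singleton) (auto simp: finite_group)
  finally show "(\<one>\<^bsub>A\<^esub> \<otimes>\<^bsub>A\<^esub> u) g = u g" .
qed (use assms in \<open>auto intro: mult_in_algebra one_in_algebra\<close>)

lemma comm_monoid_algebra: "comm_monoid A"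
  by (intro comm_monoidI)
    (auto simp: mult_in_algebra one_in_algebra algebra_m_assoc algebra_l_one intro: algebra_m_comm)

text \<open>Inversion reindexes the convolution. It also reverses products of group elements, and
  commutativity of the group restores their order, so conjugation is multiplicative rather than
  antimultiplicative.\<close>

lemma conj_mult:
  assumes "u \<in> carrier A" "v \<in> carrier A"
  shows "group_algebra_conj G (u \<otimes>\<^bsub>A\<^esub> v) = group_algebra_conj G u \<otimes>\<^bsub>A\<^esub> group_algebra_conj G v"
proof (rule algebra_eqI)
  fix g assume g: "g \<in> carrier G"
  note c = assms[THEN coeff_closed]
  \<comment> \<open>The double inverse is left unsimplified so that the summand is literally the one
    obtained by substituting the inverse of \<open>h\<close> for \<open>h\<close>.\<close>
  have "group_algebra_conj G (u \<otimes>\<^bsub>A\<^esub> v) g = (\<Oplus>\<^bsub>R\<^esub>h\<in>carrier G. u (inv\<^bsub>G\<^esub> h) \<otimes>\<^bsub>R\<^esub> v (inv\<^bsub>G\<^esub> (inv\<^bsub>G\<^esub> h) \<otimes>\<^bsub>G\<^esub> inv\<^bsub>G\<^esub> g))"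
    using g c by (simp add: group_algebra_conj_def mult_coeff del: G.inv_inv)
      (intro R.finsum_reindex_bij G.bij_betw_inv, auto)
  also have "\<dots> = (group_algebra_conj G u \<otimes>\<^bsub>A\<^esub> group_algebra_conj G v) g"
    unfolding mult_coeff[OF g] using g c
    by (intro R.finsum_cong') (auto simp: group_algebra_conj_def G.inv_mult_group G.m_comm)
  finally show "group_algebra_conj G (u \<otimes>\<^bsub>A\<^esub> v) g = (group_algebra_conj G u \<otimes>\<^bsub>A\<^esub> group_algebra_conj G v) g" .
qed (intro mult_in_algebra conj_in_algebra assms)+

lemma conj_one: "group_algebra_conj G \<one>\<^bsub>A\<^esub> = \<one>\<^bsub>A\<^esub>"
proof (rule algebra_eqI)
  fix g assume "g \<in> carrier G"
  then show "group_algebra_conj G \<one>\<^bsub>A\<^esub> g = \<one>\<^bsub>A\<^esub> g"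
    by (simp add: group_algebra_conj_def one_coeff)
qed (intro conj_in_algebra one_in_algebra)+

end

section \<open>Abelian extensions with a normal generator\<close>

locale galois_extension = field L + K: subfield K L for K and L (structure)
begin

abbreviation G where "G \<equiv> galois_group L K"
abbreviation A where "A \<equiv> galois_algebra L K"
abbreviation act where "act \<equiv> galois_action L K"

lemma K_subring: "subring K L" and K_sub: "K \<subseteq> carrier L"
  using K.subring_axioms K.subset by auto

lemma aut_ring_hom: "\<sigma> \<in> carrier G \<Longrightarrow> \<sigma> \<in> ring_hom L L"
  by (simp add: galois_group_def)

lemma aut_closed [simp]: "\<sigma> \<in> carrier G \<Longrightarrow> x \<in> carrier L \<Longrightarrow> \<sigma> x \<in> carrier L"
  by (rule ring_hom_closed[OF aut_ring_hom])

lemma aut_mult: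
  "\<sigma> \<in> carrier G \<Longrightarrow> x \<in> carrier L \<Longrightarrow> y \<in> carrier L \<Longrightarrow> \<sigma> (x \<otimes> y) = \<sigma> x \<otimes> \<sigma> y"
  by (rule ring_hom_mult[OF aut_ring_hom])

lemma aut_add:
  "\<sigma> \<in> carrier G \<Longrightarrow> x \<in> carrier L \<Longrightarrow> y \<in> carrier L \<Longrightarrow> \<sigma> (x \<oplus> y) = \<sigma> x \<oplus> \<sigma> y"
  by (rule ring_hom_add[OF aut_ring_hom])

lemma aut_one: "\<sigma> \<in> carrier G \<Longrightarrow> \<sigma> \<one> = \<one>"
  by (rule ring_hom_one[OF aut_ring_hom])

lemma aut_finsum:
  assumes "\<sigma> \<in> carrier G" "f \<in> I \<rightarrow> carrier L"
  shows "\<sigma> (\<Oplus>i\<in>I. f i) = (\<Oplus>i\<in>I. \<sigma> (f i))"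
proof -
  interpret ring_hom_cring L L \<sigma>
    by (intro ring_hom_cringI is_cring aut_ring_hom assms)
  show ?thesis using hom_finsum[OF assms(2)] by (simp add: comp_def)
qed

lemma aut_fix: "\<sigma> \<in> carrier G \<Longrightarrow> x \<in> K \<Longrightarrow> \<sigma> x = x"
  by (auto simp: galois_group_def)

lemma galois_mult_apply:
  "\<sigma> \<in> carrier G \<Longrightarrow> \<tau> \<in> carrier G \<Longrightarrow> x \<in> carrier L \<Longrightarrow> (\<sigma> \<otimes>\<^bsub>G\<^esub> \<tau>) x = \<sigma> (\<tau> x)"
  by (simp add: galois_group_def BijGroup_def compose_def)

lemma galois_one_apply: "x \<in> carrier L \<Longrightarrow> \<one>\<^bsub>G\<^esub> x = x"
  by (simp add: galois_group_def BijGroup_def)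

lemma galois_eqI:
  assumes "\<sigma> \<in> carrier G" "\<tau> \<in> carrier G" "\<And>x. x \<in> carrier L \<Longrightarrow> \<sigma> x = \<tau> x"
  shows "\<sigma> = \<tau>"
  using assms by (auto simp: galois_group_def Bij_def intro: extensionalityI)

text \<open>The substantial point is closure under inverses: the set-theoretic inverse of a
  bijective homomorphism respects both operations, as is seen by applying \<sigma> and cancelling
  it.\<close>

lemma subgroup_galois: "subgroup (carrier G) (BijGroup (carrier L))"
proof -
  have "subgroup {\<sigma> \<in> Bij (carrier L). \<sigma> \<in> ring_hom L L \<and> (\<forall>x\<in>K. \<sigma> x = x)} (BijGroup (carrier L))"
    (is "subgroup ?G _")
  proof (rule group.subgroupI[OF group_BijGroup])
    show "?G \<subseteq> carrier (BijGroup (carrier L))" by (auto simp: BijGroup_def)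
    have "(\<lambda>x\<in>carrier L. x) \<in> ?G"
      using K_sub by (auto simp: id_Bij ring_hom_def)
    then show "?G \<noteq> {}" by blast
  next
    fix \<sigma> assume s: "\<sigma> \<in> ?G"
    then have b: "bij_betw \<sigma> (carrier L) (carrier L)" by (simp add: Bij_def)
    let ?\<tau> = "inv_into (carrier L) \<sigma>"
    have hom: "\<sigma> \<in> ring_hom L L" using s by simp
    have closed: "?\<tau> x \<in> carrier L" and right: "\<sigma> (?\<tau> x) = x" if "x \<in> carrier L" for x
      using bij_betwE[OF bij_betw_inv_into[OF b]] bij_betw_inv_into_right[OF b] that by simp_all
    note left = bij_betw_inv_into_left[OF b]
    have "?\<tau> (x \<otimes> y) = ?\<tau> x \<otimes> ?\<tau> y" if "x \<in> carrier L" "y \<in> carrier L" for x y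
      using left[of "?\<tau> x \<otimes> ?\<tau> y"] that by (simp add: ring_hom_mult[OF hom] closed right)
    moreover have "?\<tau> (x \<oplus> y) = ?\<tau> x \<oplus> ?\<tau> y" if "x \<in> carrier L" "y \<in> carrier L" for x y
      using left[of "?\<tau> x \<oplus> ?\<tau> y"] that by (simp add: ring_hom_add[OF hom] closed right)
    moreover have "?\<tau> \<one> = \<one>" using left[of \<one>] by (simp add: ring_hom_one[OF hom])
    moreover have "?\<tau> x = x" if "x \<in> K" for x
      using left[of x] s that K_sub by auto
    ultimately show "inv\<^bsub>BijGroup (carrier L)\<^esub> \<sigma> \<in> ?G"
      using s closed K_sub by (auto simp: inv_BijGroup restrict_inv_into_Bij ring_hom_def)
  next
    fix \<sigma> \<tau> assume s: "\<sigma> \<in> ?G" and t: "\<tau> \<in> ?G"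
    then show "\<sigma> \<otimes>\<^bsub>BijGroup (carrier L)\<^esub> \<tau> \<in> ?G"
      using K_sub compose_Bij[of \<sigma> _ \<tau>] by (auto simp: BijGroup_def ring_hom_def compose_def Pi_def)
  qed
  then show ?thesis by (simp add: galois_group_def)
qed

lemma group_galois: "group G"
  using subgroup.subgroup_is_group[OF subgroup_galois group_BijGroup]
  by (simp add: galois_group_def)

end

section \<open>The action of the group algebra on the extension\<close>

locale abelian_galois_extension = galois_extension +
  assumes comm_group_galois: "comm_group (galois_group L K)"
    and finite_galois: "finite (carrier (galois_group L K))"
begin

sublocale alg: finite_comm_group_algebra "L\<lparr>carrier := K\<rparr>" "galois_group L K"
  using comm_group_galois finite_galois K.subcring_axioms K_sub
  by (auto simp: finite_comm_group_algebra_def finite_comm_group_algebra_axioms_def subcring_iff)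

lemma coeff_in_K: "u \<in> carrier A \<Longrightarrow> \<sigma> \<in> carrier G \<Longrightarrow> u \<sigma> \<in> K"
  using alg.coeff_closed by simp

lemma coeff_in_L: "u \<in> carrier A \<Longrightarrow> \<sigma> \<in> carrier G \<Longrightarrow> u \<sigma> \<in> carrier L"
  using coeff_in_K K_sub by blast

lemma algebra_memI: "(\<And>\<sigma>. \<sigma> \<in> carrier G \<Longrightarrow> f \<sigma> \<in> K) \<Longrightarrow> (\<lambda>\<sigma>\<in>carrier G. f \<sigma>) \<in> carrier A"
  by (simp add: group_algebra_def)

lemma galois_mult_coeff:
  assumes "u \<in> carrier A" "v \<in> carrier A" "\<sigma> \<in> carrier G"
  shows "(u \<otimes>\<^bsub>A\<^esub> v) \<sigma> = (\<Oplus>\<tau>\<in>carrier G. u \<tau> \<otimes> v (inv\<^bsub>G\<^esub> \<tau> \<otimes>\<^bsub>G\<^esub> \<sigma>))"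
  using alg.mult_coeff[OF assms(3), of u v] assms coeff_in_K subringE(6)[OF K_subring]
  by (simp add: subring_finsum_consistent[OF K_subring])

lemma act_closed: "u \<in> carrier A \<Longrightarrow> x \<in> carrier L \<Longrightarrow> act u x \<in> carrier L"
  unfolding galois_action_def by (intro finsum_closed) (auto simp: coeff_in_L)

lemma aut_act:
  assumes "u \<in> carrier A" "x \<in> carrier L" "\<sigma> \<in> carrier G"
  shows "\<sigma> (act u x) = (\<Oplus>\<tau>\<in>carrier G. u \<tau> \<otimes> (\<sigma> \<otimes>\<^bsub>G\<^esub> \<tau>) x)"
  unfolding galois_action_def using assms
  by (subst aut_finsum)
    (auto simp: coeff_in_L aut_mult aut_fix coeff_in_K galois_mult_apply intro!: finsum_cong')

text \<open>This makes \<open>L\<close> a module over K[G]. Replacing \<sigma> by the product of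
  \<tau> and \<sigma> in the convolution separates the sums, and \<tau> passes through the
  coefficients of \<open>v\<close> because it fixes \<open>K\<close>.\<close>

lemma act_mult:
  assumes "u \<in> carrier A" "v \<in> carrier A" "x \<in> carrier L"
  shows "act (u \<otimes>\<^bsub>A\<^esub> v) x = act u (act v x)"
proof -
  note c = coeff_in_L[OF assms(1)] coeff_in_L[OF assms(2)]
  have "act (u \<otimes>\<^bsub>A\<^esub> v) x
    = (\<Oplus>\<sigma>\<in>carrier G. (\<Oplus>\<tau>\<in>carrier G. u \<tau> \<otimes> v (inv\<^bsub>G\<^esub> \<tau> \<otimes>\<^bsub>G\<^esub> \<sigma>)) \<otimes> \<sigma> x)"
    unfolding galois_action_def using assms c
    by (intro finsum_cong') (auto simp: galois_mult_coeff intro!: m_closed finsum_closed)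
  also have "\<dots> = (\<Oplus>\<sigma>\<in>carrier G. \<Oplus>\<tau>\<in>carrier G. u \<tau> \<otimes> v (inv\<^bsub>G\<^esub> \<tau> \<otimes>\<^bsub>G\<^esub> \<sigma>) \<otimes> \<sigma> x)"
    using assms c
    by (intro finsum_cong' finsum_ldistr) (auto simp: finite_galois intro!: finsum_closed)
  also have "\<dots> = (\<Oplus>\<tau>\<in>carrier G. \<Oplus>\<sigma>\<in>carrier G. u \<tau> \<otimes> v (inv\<^bsub>G\<^esub> \<tau> \<otimes>\<^bsub>G\<^esub> \<sigma>) \<otimes> \<sigma> x)"
    using assms c by (intro finsum_swap) (auto simp: finite_galois)
  also have "\<dots> = (\<Oplus>\<tau>\<in>carrier G. u \<tau> \<otimes> \<tau> (act v x))"
  proof (intro finsum_cong' refl)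
    fix \<tau> assume t: "\<tau> \<in> carrier G"
    have "(\<Oplus>\<sigma>\<in>carrier G. u \<tau> \<otimes> v (inv\<^bsub>G\<^esub> \<tau> \<otimes>\<^bsub>G\<^esub> \<sigma>) \<otimes> \<sigma> x)
      = (\<Oplus>\<sigma>\<in>carrier G. u \<tau> \<otimes> v (inv\<^bsub>G\<^esub> \<tau> \<otimes>\<^bsub>G\<^esub> (\<tau> \<otimes>\<^bsub>G\<^esub> \<sigma>)) \<otimes> (\<tau> \<otimes>\<^bsub>G\<^esub> \<sigma>) x)"
      using t assms c by (intro finsum_reindex_bij alg.G.bij_betw_mult_left) auto
    also have "\<dots> = (\<Oplus>\<sigma>\<in>carrier G. u \<tau> \<otimes> (v \<sigma> \<otimes> (\<tau> \<otimes>\<^bsub>G\<^esub> \<sigma>) x))"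
    proof (intro finsum_cong' refl)
      fix \<sigma> assume s: "\<sigma> \<in> carrier G"
      have "inv\<^bsub>G\<^esub> \<tau> \<otimes>\<^bsub>G\<^esub> (\<tau> \<otimes>\<^bsub>G\<^esub> \<sigma>) = \<sigma>"
        using s t by (simp flip: alg.G.m_assoc)
      then show "u \<tau> \<otimes> v (inv\<^bsub>G\<^esub> \<tau> \<otimes>\<^bsub>G\<^esub> (\<tau> \<otimes>\<^bsub>G\<^esub> \<sigma>)) \<otimes> (\<tau> \<otimes>\<^bsub>G\<^esub> \<sigma>) x
        = u \<tau> \<otimes> (v \<sigma> \<otimes> (\<tau> \<otimes>\<^bsub>G\<^esub> \<sigma>) x)"
        using s t assms c by (simp add: m_assoc)
    qed (use t assms c in auto)
    also have "\<dots> = u \<tau> \<otimes> \<tau> (act v x)"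
      using t assms c by (subst finsum_rdistr[symmetric]) (auto simp: finite_galois aut_act)
    finally show "(\<Oplus>\<sigma>\<in>carrier G. u \<tau> \<otimes> v (inv\<^bsub>G\<^esub> \<tau> \<otimes>\<^bsub>G\<^esub> \<sigma>) \<otimes> \<sigma> x) = u \<tau> \<otimes> \<tau> (act v x)" .
  qed (use assms c act_closed in auto)
  finally show ?thesis by (simp add: galois_action_def[of L K u])
qed

section \<open>The trace and the form with values in the group algebra\<close>

definition tr where "tr x = (\<Oplus>\<sigma>\<in>carrier G. \<sigma> x)"

lemma tr_closed: "x \<in> carrier L \<Longrightarrow> tr x \<in> carrier L"
  unfolding tr_def by (intro finsum_closed) auto

lemma aut_tr:
  assumes "x \<in> carrier L" "\<sigma> \<in> carrier G"
  shows "\<sigma> (tr x) = tr x"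
proof -
  have "tr x = (\<Oplus>\<tau>\<in>carrier G. (\<sigma> \<otimes>\<^bsub>G\<^esub> \<tau>) x)"
    unfolding tr_def using assms by (intro finsum_reindex_bij alg.G.bij_betw_mult_left) auto
  also have "\<dots> = \<sigma> (tr x)"
    unfolding tr_def using assms
    by (subst aut_finsum) (auto simp: galois_mult_apply intro!: finsum_cong')
  finally show ?thesis by simp
qed

text \<open>Applying \<sigma> inside the trace translates the summation index on the right;
  commutativity makes this a left translation, which permutes the group.\<close>

lemma tr_aut:
  assumes "x \<in> carrier L" "\<sigma> \<in> carrier G"
  shows "tr (\<sigma> x) = tr x"
proof -
  have "tr x = (\<Oplus>\<tau>\<in>carrier G. (\<sigma> \<otimes>\<^bsub>G\<^esub> \<tau>) x)"
    unfolding tr_def using assms by (intro finsum_reindex_bij alg.G.bij_betw_mult_left) auto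
  also have "\<dots> = tr (\<sigma> x)"
    unfolding tr_def using assms
    by (intro finsum_cong') (auto simp: alg.G.m_comm[of \<sigma>] galois_mult_apply)
  finally show ?thesis by simp
qed

lemma tr_add:
  assumes "x \<in> carrier L" "y \<in> carrier L"
  shows "tr (x \<oplus> y) = tr x \<oplus> tr y"
proof -
  have "tr (x \<oplus> y) = (\<Oplus>\<sigma>\<in>carrier G. \<sigma> x \<oplus> \<sigma> y)"
    unfolding tr_def using assms by (intro finsum_cong') (auto simp: aut_add)
  also have "\<dots> = tr x \<oplus> tr y"
    unfolding tr_def using assms by (intro finsum_addf) auto
  finally show ?thesis .
qed

lemma tr_scale: "c \<in> K \<Longrightarrow> x \<in> carrier L \<Longrightarrow> tr (c \<otimes> x) = c \<otimes> tr x"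
  unfolding tr_def using K_sub
  by (subst finsum_rdistr) (auto simp: aut_mult aut_fix finite_galois subset_eq intro!: finsum_cong')

lemma tr_finsum:
  assumes "finite I" "f \<in> I \<rightarrow> carrier L"
  shows "tr (\<Oplus>i\<in>I. f i) = (\<Oplus>i\<in>I. tr (f i))"
  unfolding tr_def using assms
  by (subst finsum_swap[symmetric])
    (auto simp: aut_finsum finite_galois Pi_def intro!: finsum_cong' finsum_closed)

text \<open>The Hermitian form with values in K[G], packing the traces against all conjugates of
  \<open>y\<close> into one element. That its coefficients lie in \<open>K\<close> is established
  only in \<open>form_in_algebra\<close>, with the help of a normal generator.\<close>

definition form where "form x y = (\<lambda>\<sigma>\<in>carrier G. tr (x \<otimes> \<sigma> y))"

text \<open>Hermitian symmetry: the trace is invariant under \<sigma>, and applying \<sigma> to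
  \<open>x\<close> times the image of \<open>y\<close> under the inverse of \<sigma> moves the
  automorphism from \<open>y\<close> to \<open>x\<close>.\<close>

lemma conj_form:
  assumes "x \<in> carrier L" "y \<in> carrier L"
  shows "group_algebra_conj G (form x y) = form y x"
  unfolding group_algebra_conj_def
proof (rule extensionalityI[of _ "carrier G"])
  fix \<sigma> assume s: "\<sigma> \<in> carrier G"
  have "tr (x \<otimes> (inv\<^bsub>G\<^esub> \<sigma>) y) = tr (\<sigma> (x \<otimes> (inv\<^bsub>G\<^esub> \<sigma>) y))"
    using assms s by (simp add: tr_aut)
  also have "\<sigma> (x \<otimes> (inv\<^bsub>G\<^esub> \<sigma>) y) = y \<otimes> \<sigma> x"
    using assms s
    by (simp add: aut_mult m_comm galois_one_apply flip: galois_mult_apply)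
  finally show "(\<lambda>\<sigma>\<in>carrier G. form x y (inv\<^bsub>G\<^esub> \<sigma>)) \<sigma> = form y x \<sigma>"
    using s by (simp add: form_def)
qed (auto simp: form_def)

end

section \<open>Normal generators as free generators over the group algebra\<close>

locale abelian_normal_extension = abelian_galois_extension +
  fixes \<alpha>
  assumes generator_closed: "\<alpha> \<in> carrier L"
    and normal: "bij_betw (\<lambda>u. galois_action L K u \<alpha>) (carrier (galois_algebra L K)) (carrier L)"
begin

lemma act_generator_surj:
  assumes "x \<in> carrier L"
  obtains u where "u \<in> carrier A" "x = act u \<alpha>"
proof -
  have "x \<in> (\<lambda>u. act u \<alpha>) ` carrier A"
    using assms by (simp add: bij_betw_imp_surj_on[OF normal])
  then show ?thesis using that by blast
qed

lemma act_generator_inj: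
  "u \<in> carrier A \<Longrightarrow> v \<in> carrier A \<Longrightarrow> act u \<alpha> = act v \<alpha> \<Longrightarrow> u = v"
  by (rule inj_onD[OF bij_betw_imp_inj_on[OF normal]])

text \<open>The coefficients of a fixed element with respect to the normal basis are constant. Applied to
  \<open>1\<close>, this shows that \<open>Tr \<alpha>\<close> is a nonzero element of \<open>K\<close>, so no counting of roots is needed to
  identify the fixed field.\<close>

lemma fixed_imp_scaled_trace:
  assumes y: "y \<in> carrier L" and fixed: "\<forall>\<sigma>\<in>carrier G. \<sigma> y = y"
  shows "\<exists>c\<in>K. y = c \<otimes> tr \<alpha>"
proof -
  obtain u where u: "u \<in> carrier A" "y = act u \<alpha>"
    using y by (rule act_generator_surj)
  have const: "u \<sigma> = u \<one>\<^bsub>G\<^esub>" if s: "\<sigma> \<in> carrier G" for \<sigma>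
  proof -
    \<comment> \<open>The translate of \<open>u\<close> by \<sigma>, chosen so that
      \<open>act w \<alpha>\<close> is the image of \<open>act u \<alpha>\<close> under \<sigma>. As
      \<open>y\<close> is fixed, uniqueness of coefficients gives \<open>w = u\<close>; evaluation
      at \<sigma> then yields constancy.\<close>
    define w where "w = (\<lambda>\<tau>\<in>carrier G. u (inv\<^bsub>G\<^esub> \<sigma> \<otimes>\<^bsub>G\<^esub> \<tau>))"
    have w: "w \<in> carrier A"
      unfolding w_def by (rule algebra_memI) (simp add: u s coeff_in_K)
    have "act w \<alpha> = (\<Oplus>\<tau>\<in>carrier G. w (\<sigma> \<otimes>\<^bsub>G\<^esub> \<tau>) \<otimes> (\<sigma> \<otimes>\<^bsub>G\<^esub> \<tau>) \<alpha>)"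
      unfolding galois_action_def using s w generator_closed
      by (intro finsum_reindex_bij alg.G.bij_betw_mult_left) (auto simp: coeff_in_L)
    also have "\<dots> = \<sigma> (act u \<alpha>)"
      unfolding aut_act[OF u(1) generator_closed s]
    proof (intro finsum_cong' refl)
      fix \<tau> assume t: "\<tau> \<in> carrier G"
      have "inv\<^bsub>G\<^esub> \<sigma> \<otimes>\<^bsub>G\<^esub> (\<sigma> \<otimes>\<^bsub>G\<^esub> \<tau>) = \<tau>"
        using s t by (simp flip: alg.G.m_assoc)
      then show "w (\<sigma> \<otimes>\<^bsub>G\<^esub> \<tau>) \<otimes> (\<sigma> \<otimes>\<^bsub>G\<^esub> \<tau>) \<alpha> = u \<tau> \<otimes> (\<sigma> \<otimes>\<^bsub>G\<^esub> \<tau>) \<alpha>"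
        using s t by (simp add: w_def)
    qed (use s u generator_closed in \<open>auto simp: coeff_in_L\<close>)
    also have "\<dots> = act u \<alpha>" using fixed s u by simp
    finally have "w = u"
      by (rule act_generator_inj[OF w u(1)])
    then have "u \<sigma> = u (inv\<^bsub>G\<^esub> \<sigma> \<otimes>\<^bsub>G\<^esub> \<sigma>)"
      using s unfolding w_def by (metis restrict_apply')
    then show ?thesis using s by simp
  qed
  have "y = (\<Oplus>\<tau>\<in>carrier G. u \<one>\<^bsub>G\<^esub> \<otimes> \<tau> \<alpha>)"
    unfolding u(2) galois_action_def
    by (intro finsum_cong' refl arg_cong2[of _ _ _ _ "(\<otimes>)"] const)
      (use u generator_closed in \<open>auto simp: coeff_in_L\<close>)
  also have "\<dots> = u \<one>\<^bsub>G\<^esub> \<otimes> tr \<alpha>"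
    unfolding tr_def using u generator_closed
    by (intro finsum_rdistr[symmetric]) (auto simp: coeff_in_L finite_galois)
  finally show ?thesis
    using coeff_in_K[OF u(1) alg.G.one_closed] by blast
qed

lemma tr_generator: "tr \<alpha> \<in> K" "tr \<alpha> \<noteq> \<zero>"
proof -
  have "\<forall>\<sigma>\<in>carrier G. \<sigma> \<one> = \<one>" by (simp add: aut_one)
  then obtain c where c: "c \<in> K" "c \<otimes> tr \<alpha> = \<one>"
    using fixed_imp_scaled_trace[OF one_closed] by metis
  have t: "tr \<alpha> \<in> carrier L" by (rule tr_closed[OF generator_closed])
  have cL: "c \<in> carrier L" using c(1) K_sub by blast
  then show "tr \<alpha> \<noteq> \<zero>" using c(2) by auto
  have "c \<noteq> \<zero>" using c(2) t by auto
  then have d: "inv c \<in> K" using c(1) subfield_m_inv(1)[OF K.subfield_axioms] by blast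
  moreover have "tr \<alpha> = inv c"
    using comm_inv_char[OF cL t c(2)] by simp
  ultimately show "tr \<alpha> \<in> K" by simp
qed

lemma fixed_in_K:
  assumes "y \<in> carrier L" "\<forall>\<sigma>\<in>carrier G. \<sigma> y = y"
  shows "y \<in> K"
proof -
  obtain c where "c \<in> K" "y = c \<otimes> tr \<alpha>"
    using fixed_imp_scaled_trace assms by blast
  then show ?thesis using tr_generator(1) subringE(6)[OF K_subring] by simp
qed

lemma tr_in_K: "x \<in> carrier L \<Longrightarrow> tr x \<in> K"
  by (intro fixed_in_K tr_closed) (simp_all add: aut_tr)

lemma form_in_algebra: "x \<in> carrier L \<Longrightarrow> y \<in> carrier L \<Longrightarrow> form x y \<in> carrier A"
  unfolding form_def by (intro algebra_memI tr_in_K) auto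

text \<open>Linearity over K[G] in the first argument. Invariance of the trace under \<tau> moves
  \<tau> off \<open>x\<close>, so that \<open>y\<close> is hit by the inverse of \<tau> times
  \<sigma>, which is exactly the index in the convolution.\<close>

lemma form_act_left:
  assumes "u \<in> carrier A" "x \<in> carrier L" "y \<in> carrier L"
  shows "form (act u x) y = u \<otimes>\<^bsub>A\<^esub> form x y"
proof (rule alg.algebra_eqI)
  fix \<sigma> assume s: "\<sigma> \<in> carrier G"
  have "form (act u x) y \<sigma> = tr (\<Oplus>\<tau>\<in>carrier G. u \<tau> \<otimes> (\<tau> x \<otimes> \<sigma> y))"
    using s assms finsum_ldistr[OF finite_galois, of "\<sigma> y" "\<lambda>\<tau>. u \<tau> \<otimes> \<tau> x"]
    by (auto simp: form_def galois_action_def coeff_in_L m_assoc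
        intro!: arg_cong[of _ _ tr] finsum_cong')
  also have "\<dots> = (\<Oplus>\<tau>\<in>carrier G. tr (u \<tau> \<otimes> (\<tau> x \<otimes> \<sigma> y)))"
    using s assms by (intro tr_finsum finite_galois) (auto simp: coeff_in_L)
  also have "\<dots> = (\<Oplus>\<tau>\<in>carrier G. u \<tau> \<otimes> form x y (inv\<^bsub>G\<^esub> \<tau> \<otimes>\<^bsub>G\<^esub> \<sigma>))"
  proof (intro finsum_cong' refl)
    fix \<tau> assume t: "\<tau> \<in> carrier G"
    have "\<tau> (x \<otimes> (inv\<^bsub>G\<^esub> \<tau> \<otimes>\<^bsub>G\<^esub> \<sigma>) y) = \<tau> x \<otimes> \<sigma> y"
      using s t assms
      by (simp add: aut_mult galois_one_apply alg.G.m_assoc[symmetric] flip: galois_mult_apply)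
    then have "tr (\<tau> x \<otimes> \<sigma> y) = tr (x \<otimes> (inv\<^bsub>G\<^esub> \<tau> \<otimes>\<^bsub>G\<^esub> \<sigma>) y)"
      using tr_aut[of "x \<otimes> (inv\<^bsub>G\<^esub> \<tau> \<otimes>\<^bsub>G\<^esub> \<sigma>) y" \<tau>] s t assms by simp
    then show "tr (u \<tau> \<otimes> (\<tau> x \<otimes> \<sigma> y)) = u \<tau> \<otimes> form x y (inv\<^bsub>G\<^esub> \<tau> \<otimes>\<^bsub>G\<^esub> \<sigma>)"
      using s t assms by (simp add: tr_scale coeff_in_K form_def)
  qed (use s assms in \<open>auto simp: coeff_in_L form_in_algebra\<close>)
  also have "\<dots> = (u \<otimes>\<^bsub>A\<^esub> form x y) \<sigma>"
    using s assms by (simp add: galois_mult_coeff form_in_algebra)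
  finally show "form (act u x) y \<sigma> = (u \<otimes>\<^bsub>A\<^esub> form x y) \<sigma>" .
qed (use assms in \<open>auto intro!: form_in_algebra alg.mult_in_algebra act_closed\<close>)

text \<open>Hermitian symmetry turns linearity in the first argument into conjugate linearity in the
  second.\<close>

lemma form_act_act:
  assumes "u \<in> carrier A" "x \<in> carrier L"
  shows "form (act u x) (act u x) = u \<otimes>\<^bsub>A\<^esub> group_algebra_conj G u \<otimes>\<^bsub>A\<^esub> form x x"
proof -
  have "form x (act u x) = group_algebra_conj G (form (act u x) x)"
    using assms by (simp add: conj_form act_closed)
  also have "\<dots> = group_algebra_conj G u \<otimes>\<^bsub>A\<^esub> form x x"
    using assms by (simp add: form_act_left alg.conj_mult form_in_algebra conj_form)
  finally show ?thesis
    using assms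
    by (simp add: form_act_left act_closed form_in_algebra alg.conj_in_algebra alg.algebra_m_assoc)
qed

text \<open>A difference \<open>d\<close> whose products with all conjugates of \<alpha> have trace
  zero has this property against all of \<open>L\<close>, since the conjugates span. A nonzero
  \<open>d\<close> would then force the trace of \<alpha> to vanish.\<close>

lemma form_nondegenerate:
  assumes x: "x \<in> carrier L" and y: "y \<in> carrier L" and eq: "form x \<alpha> = form y \<alpha>"
  shows "x = y"
proof (rule ccontr)
  assume "x \<noteq> y"
  define d where "d = x \<ominus> y"
  have d: "d \<in> carrier L" "d \<noteq> \<zero>" using x y \<open>x \<noteq> y\<close> by (auto simp: d_def)
  then have dinv: "inv d \<in> carrier L" "d \<otimes> inv d = \<one>" by (auto simp: field_Units)
  have "x = d \<oplus> y" using x y by (simp add: d_def a_minus_def a_assoc l_neg)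
  have ortho: "tr (d \<otimes> \<sigma> \<alpha>) = \<zero>" if s: "\<sigma> \<in> carrier G" for \<sigma>
  proof -
    have "tr (x \<otimes> \<sigma> \<alpha>) = tr (d \<otimes> \<sigma> \<alpha>) \<oplus> tr (y \<otimes> \<sigma> \<alpha>)"
      using d y s generator_closed by (simp add: \<open>x = d \<oplus> y\<close> l_distr tr_add)
    moreover have "tr (x \<otimes> \<sigma> \<alpha>) = tr (y \<otimes> \<sigma> \<alpha>)"
      using fun_cong[OF eq, of \<sigma>] s by (simp add: form_def)
    ultimately show ?thesis
      using d y s generator_closed by (simp add: tr_closed)
  qed
  \<comment> \<open>The test element is chosen so that its product with \<open>d\<close> is
    \<alpha>, whose trace is known to be nonzero.\<close>
  have "inv d \<otimes> \<alpha> \<in> carrier L" using dinv generator_closed by simp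
  then obtain u where u: "u \<in> carrier A" "inv d \<otimes> \<alpha> = act u \<alpha>"
    by (rule act_generator_surj)
  have "tr (d \<otimes> act u \<alpha>) = tr (\<Oplus>\<sigma>\<in>carrier G. u \<sigma> \<otimes> (d \<otimes> \<sigma> \<alpha>))"
    unfolding galois_action_def using d u generator_closed
    by (subst finsum_rdistr) (auto simp: finite_galois coeff_in_L m_lcomm
        intro!: arg_cong[of _ _ tr] finsum_cong')
  also have "\<dots> = (\<Oplus>\<sigma>\<in>carrier G. tr (u \<sigma> \<otimes> (d \<otimes> \<sigma> \<alpha>)))"
    using d u generator_closed by (intro tr_finsum finite_galois) (auto simp: coeff_in_L)
  also have "\<dots> = (\<Oplus>\<sigma>\<in>carrier G. \<zero>)"
    using d u generator_closed
    by (intro finsum_cong') (auto simp: coeff_in_K tr_scale ortho coeff_in_L)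
  also have "\<dots> = \<zero>" by simp
  finally have "tr (d \<otimes> (inv d \<otimes> \<alpha>)) = \<zero>" using u by simp
  moreover have "d \<otimes> (inv d \<otimes> \<alpha>) = \<alpha>"
    using d dinv generator_closed by (simp flip: m_assoc)
  ultimately show False using tr_generator by simp
qed

text \<open>Multiplication by \<open>v\<close> is injective on the finite set K[G], hence
  surjective, and so one lies in its image.\<close>

lemma norm_form_solution_unit:
  assumes "finite K" and v: "v \<in> carrier A"
    and eq: "v \<otimes>\<^bsub>A\<^esub> group_algebra_conj G v = form \<alpha> \<alpha>"
  shows "v \<in> Units A"
proof -
  interpret A: comm_monoid A by (rule alg.comm_monoid_algebra)
  have "inj_on (\<lambda>u. v \<otimes>\<^bsub>A\<^esub> u) (carrier A)"
  proof (rule inj_onI)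
    fix u w assume uw: "u \<in> carrier A" "w \<in> carrier A" "v \<otimes>\<^bsub>A\<^esub> u = v \<otimes>\<^bsub>A\<^esub> w"
    \<comment> \<open>The form is \<open>x\<close> times \<open>form \<alpha> \<alpha>\<close>, that
      is, \<open>x\<close> times \<open>v\<close> times its conjugate. It therefore depends on
      \<open>x\<close> only through the product of \<open>v\<close> and \<open>x\<close>;
      nondegeneracy and normality then recover \<open>x\<close>.\<close>
    have "form (act x \<alpha>) \<alpha> = v \<otimes>\<^bsub>A\<^esub> x \<otimes>\<^bsub>A\<^esub> group_algebra_conj G v" if "x \<in> carrier A" for x
      using that v alg.conj_in_algebra[OF v] generator_closed
      by (simp add: form_act_left A.m_ac flip: eq)
    then have "form (act u \<alpha>) \<alpha> = form (act w \<alpha>) \<alpha>"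
      using uw by simp
    then have "act u \<alpha> = act w \<alpha>"
      using uw generator_closed by (intro form_nondegenerate act_closed)
    then show "u = w"
      by (rule act_generator_inj[OF uw(1,2)])
  qed
  moreover have "finite (carrier A)"
    using \<open>finite K\<close> finite_galois by (auto simp: group_algebra_def intro: finite_PiE)
  moreover have "(\<lambda>u. v \<otimes>\<^bsub>A\<^esub> u) ` carrier A \<subseteq> carrier A"
    using v by auto
  ultimately have "(\<lambda>u. v \<otimes>\<^bsub>A\<^esub> u) ` carrier A = carrier A"
    by (rule endo_inj_surj[rotated 2])
  then have "\<one>\<^bsub>A\<^esub> \<in> (\<lambda>u. v \<otimes>\<^bsub>A\<^esub> u) ` carrier A"
    by simp
  then obtain w where w: "w \<in> carrier A" "v \<otimes>\<^bsub>A\<^esub> w = \<one>\<^bsub>A\<^esub>"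
    by force
  moreover have "w \<otimes>\<^bsub>A\<^esub> v = \<one>\<^bsub>A\<^esub>"
    using A.m_comm[OF w(1) v] w(2) by simp
  ultimately show ?thesis
    using v unfolding Units_def by blast
qed

text \<open>Every \<beta> is \<open>act u \<alpha>\<close> for a unique \<open>u\<close>, and its
  form with itself is \<open>u\<close> times its conjugate times
  \<open>form \<alpha> \<alpha>\<close>. This is one exactly when \<open>u\<close> is a unit whose
  inverse solves the equation.\<close>

theorem bij_betw_norm_form_solutions:
  assumes "finite K"
  shows "bij_betw (\<lambda>v. act (inv\<^bsub>A\<^esub> v) \<alpha>)
    {v \<in> carrier A. v \<otimes>\<^bsub>A\<^esub> group_algebra_conj G v = form \<alpha> \<alpha>}
    {\<beta> \<in> carrier L. bij_betw (\<lambda>u. act u \<beta>) (carrier A) (carrier L) \<and> form \<beta> \<beta> = \<one>\<^bsub>A\<^esub>}"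
    (is "bij_betw ?f ?S ?B")
proof -
  interpret A: comm_monoid A by (rule alg.comm_monoid_algebra)
  let ?c = "group_algebra_conj G"
  note [simp] = alg.conj_in_algebra generator_closed form_in_algebra act_closed
  have unit: "v \<in> Units A" if "v \<in> ?S" for v
    using that norm_form_solution_unit[OF assms] by blast
  have conj_unit: "?c v \<otimes>\<^bsub>A\<^esub> ?c w = \<one>\<^bsub>A\<^esub>"
    if "v \<in> carrier A" "w \<in> carrier A" "v \<otimes>\<^bsub>A\<^esub> w = \<one>\<^bsub>A\<^esub>" for v w
    using alg.conj_mult[of v w] that alg.conj_one by simp
  \<comment> \<open>If \<open>w\<close> inverts \<open>v\<close>, then \<open>w\<close> times its
    conjugate inverts \<open>v\<close> times its conjugate. Both directions of the correspondence
    use this cancellation.\<close>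
  have norm_cancel: "w \<otimes>\<^bsub>A\<^esub> ?c w \<otimes>\<^bsub>A\<^esub> (v \<otimes>\<^bsub>A\<^esub> ?c v \<otimes>\<^bsub>A\<^esub> x) = x"
    if "v \<in> carrier A" "w \<in> carrier A" "w \<otimes>\<^bsub>A\<^esub> v = \<one>\<^bsub>A\<^esub>" "x \<in> carrier A" for v w x
  proof -
    have "w \<otimes>\<^bsub>A\<^esub> ?c w \<otimes>\<^bsub>A\<^esub> (v \<otimes>\<^bsub>A\<^esub> ?c v \<otimes>\<^bsub>A\<^esub> x) = (w \<otimes>\<^bsub>A\<^esub> v) \<otimes>\<^bsub>A\<^esub> ((?c w \<otimes>\<^bsub>A\<^esub> ?c v) \<otimes>\<^bsub>A\<^esub> x)"
      using that(1,2,4) by (simp add: A.m_ac)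
    then show ?thesis using that by (simp only: conj_unit A.l_one)
  qed
  show ?thesis
  proof (rule bij_betw_imageI)
    show "inj_on ?f ?S"
    proof (rule inj_onI)
      fix v w assume vw: "v \<in> ?S" "w \<in> ?S" "?f v = ?f w"
      then have "inv\<^bsub>A\<^esub> v = inv\<^bsub>A\<^esub> w"
        using unit[OF vw(1)] unit[OF vw(2)] by (intro act_generator_inj A.Units_inv_closed)
      then show "v = w"
        using A.Units_inv_inv[OF unit[OF vw(1)]] A.Units_inv_inv[OF unit[OF vw(2)]] by metis
    qed
    show "?f ` ?S = ?B"
    proof (intro equalityI subsetI)
      fix \<beta> assume "\<beta> \<in> ?f ` ?S"
      then obtain v where v: "v \<in> ?S" and \<beta>: "\<beta> = act (inv\<^bsub>A\<^esub> v) \<alpha>" by blast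
      let ?w = "inv\<^bsub>A\<^esub> v"
      have w: "?w \<in> carrier A" "?w \<otimes>\<^bsub>A\<^esub> v = \<one>\<^bsub>A\<^esub>" "v \<otimes>\<^bsub>A\<^esub> ?w = \<one>\<^bsub>A\<^esub>"
        using unit[OF v] by auto
      \<comment> \<open>The factor one is inserted to bring the product into the shape of
        \<open>norm_cancel\<close> with \<open>x\<close> equal to one.\<close>
      have "form \<beta> \<beta> = ?w \<otimes>\<^bsub>A\<^esub> ?c ?w \<otimes>\<^bsub>A\<^esub> (v \<otimes>\<^bsub>A\<^esub> ?c v \<otimes>\<^bsub>A\<^esub> \<one>\<^bsub>A\<^esub>)"
        using v w by (simp add: \<beta> form_act_act)
      also have "\<dots> = \<one>\<^bsub>A\<^esub>" using v w by (intro norm_cancel) auto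
      finally have form: "form \<beta> \<beta> = \<one>\<^bsub>A\<^esub>" .
      \<comment> \<open>Multiplication by the unit \<open>?w\<close> permutes K[G], so \<beta> is
        again a free generator of \<open>L\<close>.\<close>
      have "bij_betw (\<lambda>u. u \<otimes>\<^bsub>A\<^esub> ?w) (carrier A) (carrier A)"
        using v w by (intro bij_betw_byWitness[where f' = "\<lambda>u. u \<otimes>\<^bsub>A\<^esub> v"]) (auto simp: A.m_assoc)
      from bij_betw_trans[OF this normal]
      have "bij_betw (\<lambda>u. act (u \<otimes>\<^bsub>A\<^esub> ?w) \<alpha>) (carrier A) (carrier L)"
        by (simp add: comp_def)
      also have "?this \<longleftrightarrow> bij_betw (\<lambda>u. act u \<beta>) (carrier A) (carrier L)"
        using w by (intro bij_betw_cong) (simp add: \<beta> act_mult)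
      finally show "\<beta> \<in> ?B" using form w by (simp add: \<beta>)
    next
      fix \<beta> assume "\<beta> \<in> ?B"
      then have \<beta>: "\<beta> \<in> carrier L" "form \<beta> \<beta> = \<one>\<^bsub>A\<^esub>" by auto
      obtain u where u: "u \<in> carrier A" "\<beta> = act u \<alpha>"
        using \<beta>(1) by (rule act_generator_surj)
      have eq: "u \<otimes>\<^bsub>A\<^esub> ?c u \<otimes>\<^bsub>A\<^esub> form \<alpha> \<alpha> = \<one>\<^bsub>A\<^esub>"
        using u \<beta>(2) by (simp add: form_act_act)
      \<comment> \<open>The equation itself exhibits an inverse of \<open>u\<close>, namely the
        conjugate of \<open>u\<close> times \<open>form \<alpha> \<alpha>\<close>.\<close>
      have "u \<otimes>\<^bsub>A\<^esub> (?c u \<otimes>\<^bsub>A\<^esub> form \<alpha> \<alpha>) = \<one>\<^bsub>A\<^esub>" "(?c u \<otimes>\<^bsub>A\<^esub> form \<alpha> \<alpha>) \<otimes>\<^bsub>A\<^esub> u = \<one>\<^bsub>A\<^esub>"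
        using u eq by (simp_all add: A.m_ac)
      then have unit: "u \<in> Units A"
        using u unfolding Units_def by auto
      let ?v = "inv\<^bsub>A\<^esub> u"
      have v: "?v \<in> carrier A" "?v \<otimes>\<^bsub>A\<^esub> u = \<one>\<^bsub>A\<^esub>" using unit by auto
      have "?v \<otimes>\<^bsub>A\<^esub> ?c ?v = ?v \<otimes>\<^bsub>A\<^esub> ?c ?v \<otimes>\<^bsub>A\<^esub> (u \<otimes>\<^bsub>A\<^esub> ?c u \<otimes>\<^bsub>A\<^esub> form \<alpha> \<alpha>)"
        using v by (simp add: eq)
      also have "\<dots> = form \<alpha> \<alpha>" using v u by (intro norm_cancel) auto
      finally have "?v \<in> ?S" using v by simp
      moreover have "\<beta> = ?f ?v" using u unit by (simp add: A.Units_inv_inv)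
      ultimately show "\<beta> \<in> ?f ` ?S" by blast
    qed
  qed
qed

end

section \<open>Finite fields\<close>

context galois_extension
begin

lemma aut_pow: "\<sigma> \<in> carrier G \<Longrightarrow> x \<in> carrier L \<Longrightarrow> \<sigma> (x [^] (k::nat)) = \<sigma> x [^] k"
  by (induction k) (simp_all add: aut_one aut_mult)

text \<open>Dedekind's argument: subtracting \<tau>(y) times the relation at \<open>x\<close> from
  the relation at the product of \<open>y\<close> and \<open>x\<close> removes \<tau>, and the
  shorter relation is trivial by induction.\<close>

lemma dedekind_independence:
  assumes "finite S" "S \<subseteq> carrier G" "c \<in> S \<rightarrow> carrier L"
    and "\<forall>x\<in>carrier L. (\<Oplus>\<sigma>\<in>S. c \<sigma> \<otimes> \<sigma> x) = \<zero>"
  shows "\<forall>\<sigma>\<in>S. c \<sigma> = \<zero>"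
  using assms
proof (induction S arbitrary: c rule: finite_induct)
  case (insert \<tau> S)
  have \<tau>: "\<tau> \<in> carrier G" "c \<tau> \<in> carrier L" using insert.prems by auto
  have S: "\<sigma> \<in> carrier G" "c \<sigma> \<in> carrier L" if "\<sigma> \<in> S" for \<sigma>
    using insert.prems that by auto
  have sum_zero: "c \<tau> \<otimes> \<tau> x \<oplus> (\<Oplus>\<sigma>\<in>S. c \<sigma> \<otimes> \<sigma> x) = \<zero>" if x: "x \<in> carrier L" for x
  proof -
    have "(\<Oplus>\<sigma>\<in>insert \<tau> S. c \<sigma> \<otimes> \<sigma> x) = c \<tau> \<otimes> \<tau> x \<oplus> (\<Oplus>\<sigma>\<in>S. c \<sigma> \<otimes> \<sigma> x)"
      using insert.hyps S \<tau> x by (intro finsum_insert) auto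
    then show ?thesis using insert.prems(3) x by simp
  qed
  have S_zero: "c \<rho> = \<zero>" if \<rho>: "\<rho> \<in> S" for \<rho>
  proof -
    have "\<rho> \<noteq> \<tau>" using \<rho> insert.hyps by auto
    then obtain y where y: "y \<in> carrier L" "\<rho> y \<noteq> \<tau> y"
      using galois_eqI[OF S(1)[OF \<rho>] \<tau>(1)] by blast
    \<comment> \<open>The coefficients of the shortened relation. As \<open>y\<close> separates
      \<rho> from \<tau>, vanishing of \<open>d \<rho>\<close> forces \<open>c \<rho>\<close> to
      vanish.\<close>
    define d where "d \<sigma> = c \<sigma> \<otimes> (\<sigma> y \<ominus> \<tau> y)" for \<sigma>
    have d: "d \<sigma> \<in> carrier L" if "\<sigma> \<in> S" for \<sigma>
      using S[OF that] \<tau> y by (simp add: d_def)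
    have "(\<Oplus>\<sigma>\<in>S. d \<sigma> \<otimes> \<sigma> x) = \<zero>" if x: "x \<in> carrier L" for x
    proof -
      let ?B = "\<Oplus>\<sigma>\<in>S. c \<sigma> \<otimes> \<sigma> (y \<otimes> x)" and ?C = "\<Oplus>\<sigma>\<in>S. \<tau> y \<otimes> (c \<sigma> \<otimes> \<sigma> x)"
      and ?a = "\<tau> y \<otimes> (c \<tau> \<otimes> \<tau> x)"
      have closed: "?B \<in> carrier L" "?C \<in> carrier L" "(\<Oplus>\<sigma>\<in>S. d \<sigma> \<otimes> \<sigma> x) \<in> carrier L"
        using S \<tau> x y d by (auto intro!: finsum_closed)
      have "\<tau> y \<otimes> (c \<tau> \<otimes> \<tau> x \<oplus> (\<Oplus>\<sigma>\<in>S. c \<sigma> \<otimes> \<sigma> x)) = \<tau> y \<otimes> (c \<tau> \<otimes> \<tau> x) \<oplus> ?C"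
        using S \<tau> x y insert.hyps(1)
        by (subst r_distr) (auto simp: finsum_rdistr intro!: finsum_closed)
      then have C: "?a \<oplus> ?C = \<zero>"
        using x y \<tau> by (simp add: sum_zero)
      have "c \<tau> \<otimes> \<tau> (y \<otimes> x) = ?a"
        using \<tau> x y by (simp add: aut_mult m_lcomm)
      then have B: "?a \<oplus> ?B = \<zero>"
        using sum_zero[OF m_closed[OF y(1) x]] by (simp only:)
      have a: "?a \<in> carrier L" using \<tau> x y by simp
      have "\<ominus> ?a = z" if "z \<in> carrier L" "?a \<oplus> z = \<zero>" for z
        using minus_equality[of z ?a] a_comm[OF a that(1)] that a by simp
      \<comment> \<open>Both sums are the additive inverse of the same \<tau> term.\<close>
      from this[OF closed(1) B] this[OF closed(2) C] have "?B = ?C" by (rule trans[OF sym])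
      have "?B = (\<Oplus>\<sigma>\<in>S. d \<sigma> \<otimes> \<sigma> x \<oplus> \<tau> y \<otimes> (c \<sigma> \<otimes> \<sigma> x))"
      proof (intro finsum_cong' refl)
        fix \<sigma> assume \<sigma>: "\<sigma> \<in> S"
        have "\<sigma> y = (\<sigma> y \<ominus> \<tau> y) \<oplus> \<tau> y"
          using S[OF \<sigma>] \<tau> y by (simp add: a_minus_def a_assoc l_neg)
        then have "c \<sigma> \<otimes> \<sigma> (y \<otimes> x) = c \<sigma> \<otimes> (((\<sigma> y \<ominus> \<tau> y) \<oplus> \<tau> y) \<otimes> \<sigma> x)"
          using S[OF \<sigma>] x y by (simp only: aut_mult)
        also have "\<dots> = d \<sigma> \<otimes> \<sigma> x \<oplus> \<tau> y \<otimes> (c \<sigma> \<otimes> \<sigma> x)"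
          using S[OF \<sigma>] \<tau> x y
          by (simp add: d_def l_distr r_distr m_assoc m_lcomm[of "\<tau> y"])
        finally show "c \<sigma> \<otimes> \<sigma> (y \<otimes> x) = d \<sigma> \<otimes> \<sigma> x \<oplus> \<tau> y \<otimes> (c \<sigma> \<otimes> \<sigma> x)" .
      qed (use S \<tau> x y d in auto)
      also have "\<dots> = (\<Oplus>\<sigma>\<in>S. d \<sigma> \<otimes> \<sigma> x) \<oplus> ?C"
        using S \<tau> x y d by (intro finsum_addf) auto
      finally have "(\<Oplus>\<sigma>\<in>S. d \<sigma> \<otimes> \<sigma> x) \<oplus> ?C = ?C"
        using \<open>?B = ?C\<close> by simp
      then show ?thesis
        using closed by (simp add: add.r_cancel_one)
    qed
    then have "\<forall>\<sigma>\<in>S. d \<sigma> = \<zero>"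
      using insert.prems(1) d by (intro insert.IH) auto
    then have "c \<rho> \<otimes> (\<rho> y \<ominus> \<tau> y) = \<zero>" using \<rho> by (simp add: d_def)
    moreover have "\<rho> y \<ominus> \<tau> y \<noteq> \<zero>" using S[OF \<rho>] \<tau> y by simp
    ultimately show ?thesis
      using S[OF \<rho>] \<tau> y by (simp add: integral_iff)
  qed
  \<comment> \<open>Evaluating the original relation at one isolates the last coefficient
    \<open>c \<tau>\<close>.\<close>
  have "(\<Oplus>\<sigma>\<in>S. c \<sigma> \<otimes> \<sigma> \<one>) = (\<Oplus>\<sigma>\<in>S. \<zero>)"
    using S by (intro finsum_cong') (auto simp: S_zero)
  then have "c \<tau> = \<zero>" using sum_zero[of \<one>] \<tau> by (simp add: aut_one)
  then show ?case using S_zero by simp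
qed simp

end

section \<open>Powers of Frobenius as automorphisms\<close>

locale finite_field_extension = galois_extension +
  fixes q n :: nat
  assumes primepow_q: "primepow q" and n_pos: "n \<ge> 1"
    and card_K: "card K = q" and card_L: "card (carrier L) = q ^ n"
begin

lemma finite_L: "finite (carrier L)"
  using card_L primepow_gt_Suc_0[OF primepow_q] by (intro card_ge_0_finite) simp

lemma finite_K: "finite K"
  using finite_L K_sub by (rule rev_finite_subset)

lemma pow_q_add:
  assumes "x \<in> carrier L" "y \<in> carrier L"
  shows "(x \<oplus> y) [^] (q ^ i) = x [^] (q ^ i) \<oplus> y [^] (q ^ i)"
proof -
  obtain p k where p: "prime p" "q = p ^ k"
    using primepow_q by (auto simp: primepow_def)
  have "[p] \<cdot> \<one> = \<zero>"
    by (rule char_of_prime_power_card[of p "k * n"]) (simp_all add: card_L p(2) power_mult finite_L)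
  then show ?thesis
    using prime_power_add[of p x y "k * i"] p assms by (simp add: power_mult)
qed

lemma pow_q_fix:
  assumes "x \<in> K"
  shows "x [^] (q ^ i) = x"
proof (induction i)
  case 0
  then show ?case using assms K_sub by auto
next
  case (Suc i)
  interpret KF: field "L\<lparr>carrier := K\<rparr>"
    by (rule subfield_iff(2)[OF K.subfield_axioms])
  have "x [^] q = x"
    using KF.pow_card_eq[of x] finite_K assms by (simp add: card_K flip: nat_pow_consistent)
  moreover have "x [^] (q ^ Suc i) = (x [^] q) [^] (q ^ i)"
    using assms K_sub by (subst nat_pow_pow) auto
  ultimately show ?case using Suc by simp
qed

lemma pow_q_periodic:
  assumes "x \<in> carrier L"
  shows "x [^] (q ^ (n * i)) = x"
proof (induction i)
  case (Suc i)
  have "x [^] (q ^ (n * Suc i)) = (x [^] (q ^ n)) [^] (q ^ (n * i))"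
    using assms by (simp add: nat_pow_pow power_add)
  then show ?case using Suc pow_card_eq[OF finite_L assms] by (simp add: card_L)
qed (simp add: assms)

text \<open>The \<open>i\<close>-th power of Frobenius, restricted to the carrier because elements
  of \<open>Bij\<close> are extensional.\<close>

definition frob where "frob i = (\<lambda>x\<in>carrier L. x [^] (q ^ i))"

lemma frob_apply: "x \<in> carrier L \<Longrightarrow> frob i x = x [^] (q ^ i)"
  by (simp add: frob_def)

text \<open>A further power of Frobenius undoes \<open>frob i\<close>, since raising to the power
  \<open>q ^ (n * i)\<close> is the identity. This gives injectivity, and finiteness gives
  surjectivity.\<close>

lemma frob_in_galois: "frob i \<in> carrier G"
proof -
  have inj: "inj_on (frob i) (carrier L)"
  proof (rule inj_on_inverseI)
    fix x assume x: "x \<in> carrier L"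
    \<comment> \<open>The subtraction is on natural numbers; it is exact because \<open>n\<close> is
      at least 1.\<close>
    have "i + (n * i - i) = n * i" using n_pos by (cases n) auto
    then show "(frob i x) [^] (q ^ (n * i - i)) = x"
      using x pow_q_periodic[OF x, of i] by (simp add: frob_apply nat_pow_pow flip: power_add)
  qed
  have "frob i ` carrier L \<subseteq> carrier L" by (simp add: frob_apply image_subset_iff)
  from endo_inj_surj[OF finite_L this inj] inj
  have "bij_betw (frob i) (carrier L) (carrier L)" by (intro bij_betw_imageI)
  moreover have "frob i \<in> ring_hom L L"
    by (rule ring_hom_memI) (simp_all add: frob_apply pow_q_add nat_pow_distrib)
  ultimately show ?thesis
    using K_sub by (auto simp: galois_group_def Bij_def frob_def pow_q_fix)
qed

lemma frob_pow: "x \<in> carrier L \<Longrightarrow> frob j (x [^] (q ^ i)) = x [^] (q ^ (i + j))"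
  by (simp add: frob_apply nat_pow_pow power_add)

lemma frob_mult: "frob i \<otimes>\<^bsub>G\<^esub> frob j = frob (i + j)"
proof (rule galois_eqI)
  interpret GG: group G by (rule group_galois)
  show "frob i \<otimes>\<^bsub>G\<^esub> frob j \<in> carrier G" by (simp add: frob_in_galois)
  fix x assume x: "x \<in> carrier L"
  have "(frob i \<otimes>\<^bsub>G\<^esub> frob j) x = frob i (frob j x)"
    by (rule galois_mult_apply[OF frob_in_galois frob_in_galois x])
  also have "\<dots> = frob (i + j) x"
    using frob_pow[OF x, of i j] by (simp only: frob_apply[OF x] add.commute)
  finally show "(frob i \<otimes>\<^bsub>G\<^esub> frob j) x = frob (i + j) x" .
qed (rule frob_in_galois)

lemma frob_zero: "frob 0 = \<one>\<^bsub>G\<^esub>"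
proof (rule galois_eqI)
  interpret GG: group G by (rule group_galois)
  show "\<one>\<^bsub>G\<^esub> \<in> carrier G" by simp
qed (simp_all add: frob_in_galois frob_apply galois_one_apply)

lemma normal_basis_iff:
  "generates_normal_basis L K q n \<beta> \<longleftrightarrow> \<beta> \<in> carrier L \<and>
    bij_betw (\<lambda>c. \<Oplus>i\<in>{..<n}. c i \<otimes> \<beta> [^] (q ^ i)) ({..<n} \<rightarrow>\<^sub>E K) (carrier L)"
proof (cases "\<beta> \<in> carrier L")
  case True
  then show ?thesis
    using basis_iff_bij_betw[OF K.subfield_axioms, of "\<lambda>i. \<beta> [^] (q ^ i)" n]
    by (simp add: generates_normal_basis_def del: Span.simps)
qed (simp add: generates_normal_basis_def)

end

section \<open>Identification of the Galois group\<close>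

locale finite_field_normal_generator = finite_field_extension +
  fixes \<alpha>
  assumes normal_generator: "generates_normal_basis L K q n \<alpha>"
begin

lemma gen_closed: "\<alpha> \<in> carrier L"
  using normal_generator by (simp add: normal_basis_iff)

lemma normal_expansion:
  assumes "x \<in> carrier L"
  obtains c where "c \<in> {..<n} \<rightarrow>\<^sub>E K" "x = (\<Oplus>i\<in>{..<n}. c i \<otimes> \<alpha> [^] (q ^ i))"
proof -
  have "x \<in> (\<lambda>c. \<Oplus>i\<in>{..<n}. c i \<otimes> \<alpha> [^] (q ^ i)) ` ({..<n} \<rightarrow>\<^sub>E K)"
    using normal_generator assms by (simp add: normal_basis_iff bij_betw_def)
  then show ?thesis by (rule imageE) (rule that)
qed

text \<open>The coefficients are those of \<sigma>(\<alpha>) in the normal basis. Both sides are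
  \<open>K\<close>-linear and commute with Frobenius, so agreement at \<alpha> spreads to all its
  conjugates and hence to \<open>L\<close>.\<close>

lemma aut_eq_frob_combination:
  assumes \<sigma>: "\<sigma> \<in> carrier G"
  shows "\<exists>c\<in>{..<n} \<rightarrow> K. \<forall>x\<in>carrier L. \<sigma> x = (\<Oplus>i\<in>{..<n}. c i \<otimes> frob i x)"
proof -
  obtain c where c: "c \<in> {..<n} \<rightarrow>\<^sub>E K" "\<sigma> \<alpha> = (\<Oplus>i\<in>{..<n}. c i \<otimes> \<alpha> [^] (q ^ i))"
    using normal_expansion[OF aut_closed[OF \<sigma> gen_closed]] .
  note cK = PiE_mem[OF c(1)]
  have cL: "c i \<in> carrier L" if "i < n" for i using cK K_sub that by auto
  have frob_expand: "frob j (\<Oplus>i\<in>{..<n}. d i \<otimes> \<alpha> [^] (q ^ i)) = (\<Oplus>i\<in>{..<n}. d i \<otimes> \<alpha> [^] (q ^ (i + j)))"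
    if d: "\<And>i. i < n \<Longrightarrow> d i \<in> K" "\<And>i. i < n \<Longrightarrow> d i \<in> carrier L" for d j
    using d gen_closed
    by (subst aut_finsum[OF frob_in_galois])
      (auto simp: aut_mult[OF frob_in_galois] aut_fix[OF frob_in_galois] frob_pow
        intro!: finsum_cong')
  have "\<sigma> x = (\<Oplus>i\<in>{..<n}. c i \<otimes> frob i x)" if x: "x \<in> carrier L" for x
  proof -
    obtain d where d: "d \<in> {..<n} \<rightarrow>\<^sub>E K" "x = (\<Oplus>i\<in>{..<n}. d i \<otimes> \<alpha> [^] (q ^ i))"
      using normal_expansion[OF x] .
    note dK = PiE_mem[OF d(1)]
    have dL: "d i \<in> carrier L" if "i < n" for i using dK K_sub that by auto
    \<comment> \<open>As \<sigma> preserves powers, its value at a conjugate of \<alpha> is the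
      corresponding power of Frobenius applied to \<sigma>(\<alpha>).\<close>
    have "\<sigma> x = (\<Oplus>j\<in>{..<n}. d j \<otimes> frob j (\<sigma> \<alpha>))"
      unfolding d(2) using \<sigma> dK dL gen_closed
      by (subst aut_finsum) (auto simp: aut_mult aut_fix aut_pow frob_apply intro!: finsum_cong')
    also have "\<dots> = (\<Oplus>j\<in>{..<n}. \<Oplus>i\<in>{..<n}. d j \<otimes> (c i \<otimes> \<alpha> [^] (q ^ (i + j))))"
    proof (intro finsum_cong' refl)
      fix j assume j: "j \<in> {..<n}"
      have "frob j (\<sigma> \<alpha>) = (\<Oplus>i\<in>{..<n}. c i \<otimes> \<alpha> [^] (q ^ (i + j)))"
        unfolding c(2) using cK cL by (intro frob_expand) auto
      then show "d j \<otimes> frob j (\<sigma> \<alpha>) = (\<Oplus>i\<in>{..<n}. d j \<otimes> (c i \<otimes> \<alpha> [^] (q ^ (i + j))))"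
        using j dL cL gen_closed by (simp add: finsum_rdistr Pi_def)
    qed (use cL dL gen_closed in \<open>auto intro!: finsum_closed\<close>)
    also have "\<dots> = (\<Oplus>i\<in>{..<n}. \<Oplus>j\<in>{..<n}. d j \<otimes> (c i \<otimes> \<alpha> [^] (q ^ (i + j))))"
      using cL dL gen_closed by (intro finsum_swap) auto
    also have "\<dots> = (\<Oplus>i\<in>{..<n}. c i \<otimes> frob i x)"
    proof (intro finsum_cong' refl)
      fix i assume i: "i \<in> {..<n}"
      have "frob i x = (\<Oplus>j\<in>{..<n}. d j \<otimes> \<alpha> [^] (q ^ (i + j)))"
        unfolding d(2) using frob_expand[of d i] dK dL by (simp add: add.commute)
      then have "c i \<otimes> frob i x = (\<Oplus>j\<in>{..<n}. c i \<otimes> (d j \<otimes> \<alpha> [^] (q ^ (i + j))))"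
        using i dL cL gen_closed by (simp add: finsum_rdistr Pi_def)
      also have "\<dots> = (\<Oplus>j\<in>{..<n}. d j \<otimes> (c i \<otimes> \<alpha> [^] (q ^ (i + j))))"
        using i dL cL gen_closed by (intro finsum_cong') (auto simp: m_lcomm)
      finally show "(\<Oplus>j\<in>{..<n}. d j \<otimes> (c i \<otimes> \<alpha> [^] (q ^ (i + j)))) = c i \<otimes> frob i x" by simp
    qed (use cL x in \<open>auto simp: frob_apply\<close>)
    finally show ?thesis .
  qed
  then show ?thesis using c(1) by (intro bexI[of _ c]) auto
qed

text \<open>Distinct powers are told apart by \<alpha>, since the members of an independent list are
  distinct.\<close>

lemma inj_on_frob: "inj_on frob {..<n}"
proof (rule inj_onI)
  fix i j assume ij: "i \<in> {..<n}" "j \<in> {..<n}" "frob i = frob j"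
  have "distinct (map (\<lambda>i. \<alpha> [^] (q ^ i)) [0..<n])"
    using normal_generator independent_distinct[OF K.subfield_axioms]
    by (simp add: generates_normal_basis_def)
  moreover have "\<alpha> [^] (q ^ i) = \<alpha> [^] (q ^ j)"
    using fun_cong[OF ij(3), of \<alpha>] gen_closed by (simp add: frob_apply)
  ultimately show "i = j"
    using ij(1,2) by (auto simp: distinct_map inj_on_def)
qed

text \<open>Otherwise the expansion of \<sigma> in powers of Frobenius is a relation among distinct
  automorphisms in which \<sigma> has the nonzero coefficient minus one.\<close>

lemma frob_surj: "\<sigma> \<in> carrier G \<Longrightarrow> \<sigma> \<in> frob ` {..<n}"
proof (rule ccontr)
  assume \<sigma>: "\<sigma> \<in> carrier G" and not_frob: "\<sigma> \<notin> frob ` {..<n}"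
  from aut_eq_frob_combination[OF \<sigma>]
  obtain c where c: "c \<in> {..<n} \<rightarrow> K"
    "\<forall>x\<in>carrier L. \<sigma> x = (\<Oplus>i\<in>{..<n}. c i \<otimes> frob i x)" by (elim bexE)
  have cL: "c i \<in> carrier L" if "i < n" for i using c(1) K_sub that by auto
  \<comment> \<open>Dedekind's theorem indexes coefficients by automorphisms, so \<open>c\<close> is
    carried over along the injection \<open>frob\<close>, and \<sigma> gets the coefficient minus
    one.\<close>
  define e where "e \<tau> = (if \<tau> = \<sigma> then \<ominus> \<one> else c (the_inv_into {..<n} frob \<tau>))" for \<tau>
  have e_frob: "e (frob i) = c i" if "i < n" for i
    using that not_frob by (auto simp: e_def the_inv_into_f_f[OF inj_on_frob])
  have e_closed: "e \<tau> \<in> carrier L" if \<tau>: "\<tau> \<in> insert \<sigma> (frob ` {..<n})" for \<tau>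
  proof -
    consider "\<tau> = \<sigma>" | i where "i < n" "\<tau> = frob i" using \<tau> by blast
    then show ?thesis
    proof cases
      case 1
      then show ?thesis by (simp add: e_def)
    next
      case 2
      then show ?thesis using e_frob cL by simp
    qed
  qed
  have "\<forall>\<tau>\<in>insert \<sigma> (frob ` {..<n}). e \<tau> = \<zero>"
  proof (rule dedekind_independence)
    show "\<forall>x\<in>carrier L. (\<Oplus>\<tau>\<in>insert \<sigma> (frob ` {..<n}). e \<tau> \<otimes> \<tau> x) = \<zero>"
    proof
      fix x assume x: "x \<in> carrier L"
      have "(\<Oplus>\<tau>\<in>insert \<sigma> (frob ` {..<n}). e \<tau> \<otimes> \<tau> x)
        = e \<sigma> \<otimes> \<sigma> x \<oplus> (\<Oplus>\<tau>\<in>frob ` {..<n}. e \<tau> \<otimes> \<tau> x)"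
        using x \<sigma> not_frob e_closed by (intro finsum_insert) (auto simp: frob_apply)
      also have "(\<Oplus>\<tau>\<in>frob ` {..<n}. e \<tau> \<otimes> \<tau> x) = (\<Oplus>i\<in>{..<n}. e (frob i) \<otimes> frob i x)"
        using x e_closed inj_on_frob by (intro finsum_reindex) (auto simp: frob_apply)
      also have "\<dots> = (\<Oplus>i\<in>{..<n}. c i \<otimes> frob i x)"
        using x cL by (intro finsum_cong') (auto simp: e_frob frob_apply)
      also have "\<dots> = \<sigma> x" using c(2) x by simp
      also have "e \<sigma> \<otimes> \<sigma> x \<oplus> \<sigma> x = \<zero>"
        using \<sigma> x by (simp add: e_def l_minus l_neg)
      finally show "(\<Oplus>\<tau>\<in>insert \<sigma> (frob ` {..<n}). e \<tau> \<otimes> \<tau> x) = \<zero>" .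
    qed
  qed (use \<sigma> frob_in_galois e_closed in auto)
  then have "\<ominus> \<one> = \<zero>" by (simp add: e_def)
  then show False using add.inv_eq_1_iff[of \<one>] by simp
qed

lemma bij_betw_frob: "bij_betw frob {..<n} (carrier G)"
  using inj_on_frob frob_surj frob_in_galois by (auto simp: bij_betw_def)

text \<open>Numbering the group by \<open>frob\<close> identifies K[G] with the coordinate vectors
  of length \<open>n\<close>, and turns the action on \<beta> into the coordinate map of its
  conjugates.\<close>

lemma bij_betw_act_iff:
  assumes \<beta>: "\<beta> \<in> carrier L"
  shows "bij_betw (\<lambda>u. act u \<beta>) (carrier A) (carrier L) \<longleftrightarrow> generates_normal_basis L K q n \<beta>"
proof -
  let ?\<rho> = "\<lambda>u. \<lambda>i\<in>{..<n}. u (frob i)" and ?f = "\<lambda>c. \<Oplus>i\<in>{..<n}. c i \<otimes> \<beta> [^] (q ^ i)"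
  let ?inv = "the_inv_into {..<n} frob"
  have A: "carrier A = carrier G \<rightarrow>\<^sub>E K" by (simp add: group_algebra_def)
  have inv: "?inv \<sigma> < n" "frob (?inv \<sigma>) = \<sigma>" if "\<sigma> \<in> carrier G" for \<sigma>
    using the_inv_into_into[OF inj_on_frob frob_surj[OF that] order_refl]
      f_the_inv_into_f[OF inj_on_frob frob_surj[OF that]] by auto
  have \<rho>: "bij_betw ?\<rho> (carrier A) ({..<n} \<rightarrow>\<^sub>E K)"
    unfolding A
  proof (rule bij_betw_byWitness[where f' = "\<lambda>c. \<lambda>\<sigma>\<in>carrier G. c (?inv \<sigma>)"])
    show "\<forall>u\<in>carrier G \<rightarrow>\<^sub>E K. (\<lambda>\<sigma>\<in>carrier G. ?\<rho> u (?inv \<sigma>)) = u"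
      by (auto simp: inv PiE_def intro!: extensionalityI[of _ "carrier G"])
    show "\<forall>c\<in>{..<n} \<rightarrow>\<^sub>E K. ?\<rho> (\<lambda>\<sigma>\<in>carrier G. c (?inv \<sigma>)) = c"
      by (auto simp: PiE_def frob_in_galois the_inv_into_f_f[OF inj_on_frob]
          intro!: extensionalityI[of _ "{..<n}"])
    show "?\<rho> ` (carrier G \<rightarrow>\<^sub>E K) \<subseteq> {..<n} \<rightarrow>\<^sub>E K"
    proof (rule image_subsetI)
      fix u assume u: "u \<in> carrier G \<rightarrow>\<^sub>E K"
      show "?\<rho> u \<in> {..<n} \<rightarrow>\<^sub>E K" using PiE_mem[OF u frob_in_galois] by simp
    qed
    show "(\<lambda>c. \<lambda>\<sigma>\<in>carrier G. c (?inv \<sigma>)) ` ({..<n} \<rightarrow>\<^sub>E K) \<subseteq> carrier G \<rightarrow>\<^sub>E K"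
    proof (rule image_subsetI)
      fix c assume c: "c \<in> {..<n} \<rightarrow>\<^sub>E K"
      show "(\<lambda>\<sigma>\<in>carrier G. c (?inv \<sigma>)) \<in> carrier G \<rightarrow>\<^sub>E K"
        using PiE_mem[OF c] inv(1) by simp
    qed
  qed
  have "act u \<beta> = ?f (?\<rho> u)" if "u \<in> carrier A" for u
  proof -
    have uL: "u \<sigma> \<in> carrier L" if "\<sigma> \<in> carrier G" for \<sigma>
      using \<open>u \<in> carrier A\<close> K_sub that by (auto simp: A)
    have "act u \<beta> = (\<Oplus>i\<in>{..<n}. u (frob i) \<otimes> frob i \<beta>)"
      unfolding galois_action_def using uL \<beta> by (intro finsum_reindex_bij[OF bij_betw_frob]) auto
    also have "\<dots> = ?f (?\<rho> u)"
      using uL \<beta> frob_in_galois by (intro finsum_cong') (auto simp: frob_apply)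
    finally show ?thesis .
  qed
  then have "bij_betw (\<lambda>u. act u \<beta>) (carrier A) (carrier L) \<longleftrightarrow> bij_betw (?f \<circ> ?\<rho>) (carrier A) (carrier L)"
    by (intro bij_betw_cong) simp
  also have "\<dots> \<longleftrightarrow> bij_betw ?f ({..<n} \<rightarrow>\<^sub>E K) (carrier L)"
    by (rule bij_betw_comp_iff[OF \<rho>, symmetric])
  finally show ?thesis using \<beta> by (simp add: normal_basis_iff)
qed

text \<open>Products of Frobenius powers add exponents, so the group is commutative;
  \<open>bij_betw_act_iff\<close> turns the normal basis into a free generator.\<close>

sublocale abelian_normal_extension K L \<alpha>
proof (intro abelian_normal_extension.intro abelian_normal_extension_axioms.intro
    abelian_galois_extension.intro abelian_galois_extension_axioms.intro)
  show "galois_extension K L" by (rule galois_extension_axioms)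
  interpret GG: group G by (rule group_galois)
  show "comm_group G"
  proof (rule GG.group_comm_groupI)
    fix \<sigma> \<tau> assume "\<sigma> \<in> carrier G" "\<tau> \<in> carrier G"
    then obtain i j where "\<sigma> = frob i" "\<tau> = frob j" using frob_surj by blast
    then show "\<sigma> \<otimes>\<^bsub>G\<^esub> \<tau> = \<tau> \<otimes>\<^bsub>G\<^esub> \<sigma>" by (simp add: frob_mult add.commute)
  qed
  show "finite (carrier G)" using bij_betw_finite[OF bij_betw_frob] by simp
  show "\<alpha> \<in> carrier L" by (rule gen_closed)
  show "bij_betw (\<lambda>u. act u \<alpha>) (carrier A) (carrier L)"
    using bij_betw_act_iff[OF gen_closed] normal_generator by blast
qed

text \<open>The link between the trace as a sum of powers and the trace as a sum over the group: it
  holds because the group consists of exactly the \<open>n\<close> powers of Frobenius.\<close>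

lemma field_trace_eq_tr:
  assumes "x \<in> carrier L"
  shows "field_trace L q n x = tr x"
proof -
  have "tr x = (\<Oplus>i\<in>{..<n}. frob i x)"
    unfolding tr_def using assms by (intro finsum_reindex_bij[OF bij_betw_frob]) auto
  then show ?thesis using assms by (simp add: field_trace_def frob_apply)
qed

lemma trace_element_eq_form: "\<beta> \<in> carrier L \<Longrightarrow> trace_element L K q n \<beta> = form \<beta> \<beta>"
  unfolding trace_element_def form_def by (intro restrict_ext) (simp add: field_trace_eq_tr)

text \<open>The trace of a product of two conjugates depends only on the quotient of the two
  automorphisms. The conditions with \<open>i\<close> equal to 0 are therefore already all of them,
  and they are the coefficients of the form.\<close>

lemma self_dual_iff_form_one:
  assumes \<beta>: "\<beta> \<in> carrier L"
  shows "(\<forall>i<n. \<forall>j<n. field_trace L q n (\<beta> [^] (q ^ i) \<otimes> \<beta> [^] (q ^ j)) = (if i = j then \<one> else \<zero>))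
    \<longleftrightarrow> form \<beta> \<beta> = \<one>\<^bsub>A\<^esub>" (is "?L \<longleftrightarrow> ?R")
proof -
  have trace: "field_trace L q n (\<beta> [^] (q ^ i) \<otimes> \<beta> [^] (q ^ j)) = tr (frob i \<beta> \<otimes> frob j \<beta>)" for i j
    using \<beta> by (simp add: field_trace_eq_tr frob_apply)
  show ?thesis
  proof
    assume L: ?L
    show ?R
    proof (rule alg.algebra_eqI)
      fix \<sigma> assume \<sigma>: "\<sigma> \<in> carrier G"
      then obtain j where j: "j < n" "\<sigma> = frob j" using frob_surj by blast
      have "form \<beta> \<beta> \<sigma> = tr (frob 0 \<beta> \<otimes> frob j \<beta>)"
        using \<sigma> \<beta> by (simp add: form_def j(2) frob_apply[of \<beta> 0])
      also have "\<dots> = (if 0 = j then \<one> else \<zero>)"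
        using L[rule_format, of 0 j] j(1) n_pos unfolding trace by simp
      \<comment> \<open>By injectivity of \<open>frob\<close> below \<open>n\<close>, the
        automorphism \<open>frob j\<close> is the identity only for \<open>j\<close> equal to
        0.\<close>
      also have "\<dots> = \<one>\<^bsub>A\<^esub> \<sigma>"
        using inj_onD[OF inj_on_frob, of j 0] j n_pos \<sigma>
        by (auto simp: alg.one_coeff frob_zero simp flip: frob_zero)
      finally show "form \<beta> \<beta> \<sigma> = \<one>\<^bsub>A\<^esub> \<sigma>" .
    qed (use \<beta> form_in_algebra alg.one_in_algebra in auto)
  next
    assume R: ?R
    show ?L
    proof (intro allI impI)
      fix i j assume ij: "i < n" "j < n"
      let ?s = "frob i" and ?t = "frob j"
      note st = frob_in_galois[of i] frob_in_galois[of j]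
      \<comment> \<open>Factoring out \<open>?s\<close> and using invariance of the trace reduces
        the pair to a single coefficient of the form.\<close>
      have "?s (\<beta> \<otimes> (inv\<^bsub>G\<^esub> ?s \<otimes>\<^bsub>G\<^esub> ?t) \<beta>) = ?s \<beta> \<otimes> ?t \<beta>"
        using st \<beta>
        by (simp add: aut_mult galois_one_apply alg.G.m_assoc[symmetric] flip: galois_mult_apply)
      then have "tr (?s \<beta> \<otimes> ?t \<beta>) = form \<beta> \<beta> (inv\<^bsub>G\<^esub> ?s \<otimes>\<^bsub>G\<^esub> ?t)"
        using tr_aut[of "\<beta> \<otimes> (inv\<^bsub>G\<^esub> ?s \<otimes>\<^bsub>G\<^esub> ?t) \<beta>" ?s] st \<beta> by (simp add: form_def)
      also have "\<dots> = (if inv\<^bsub>G\<^esub> ?s \<otimes>\<^bsub>G\<^esub> ?t = \<one>\<^bsub>G\<^esub> then \<one> else \<zero>)"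
        using st by (simp add: R alg.one_coeff)
      also have "inv\<^bsub>G\<^esub> ?s \<otimes>\<^bsub>G\<^esub> ?t = \<one>\<^bsub>G\<^esub> \<longleftrightarrow> i = j"
      proof
        assume one: "inv\<^bsub>G\<^esub> ?s \<otimes>\<^bsub>G\<^esub> ?t = \<one>\<^bsub>G\<^esub>"
        have "?t = ?s \<otimes>\<^bsub>G\<^esub> (inv\<^bsub>G\<^esub> ?s \<otimes>\<^bsub>G\<^esub> ?t)"
          using st by (simp flip: alg.G.m_assoc)
        then have "?s = ?t" using st by (simp add: one)
        then show "i = j" by (rule inj_onD[OF inj_on_frob]) (simp_all add: ij)
      qed (use st in simp)
      finally show "field_trace L q n (\<beta> [^] (q ^ i) \<otimes> \<beta> [^] (q ^ j)) = (if i = j then \<one> else \<zero>)"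
        by (simp add: trace)
    qed
  qed
qed

end

section \<open>Self-dual normal bases and solutions of the norm equation\<close>

theorem theorem2:
  fixes L :: "('a, 'b) ring_scheme" and K :: "'a set" and q n :: nat and \<alpha> :: 'a
  assumes "primepow q" and "n \<ge> 1"
    and "field L" and "subfield K L"
    and "card K = q" and "card (carrier L) = q ^ n"
    and "generates_normal_basis L K q n \<alpha>"
  shows "(\<forall>v \<in> trace_equation_solutions L K q n \<alpha>. v \<in> Units (galois_algebra L K)) \<and>
    bij_betw (\<lambda>v. galois_action L K (inv\<^bsub>galois_algebra L K\<^esub> v) \<alpha>)
      (trace_equation_solutions L K q n \<alpha>)
      {\<beta>. generates_self_dual_normal_basis L K q n \<beta>}"
proof -
  interpret galois_extension K L
    using assms(3,4) by (rule galois_extension.intro)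
  interpret finite_field_normal_generator K L q n \<alpha>
    by unfold_locales (use assms in auto)
  have sols: "trace_equation_solutions L K q n \<alpha> =
    {v \<in> carrier A. v \<otimes>\<^bsub>A\<^esub> group_algebra_conj G v = form \<alpha> \<alpha>}"
    by (simp add: trace_equation_solutions_def trace_element_eq_form gen_closed)
  have gens: "{\<beta>. generates_self_dual_normal_basis L K q n \<beta>} =
    {\<beta> \<in> carrier L. bij_betw (\<lambda>u. act u \<beta>) (carrier A) (carrier L) \<and> form \<beta> \<beta> = \<one>\<^bsub>A\<^esub>}"
  proof (intro Collect_cong)
    fix \<beta>
    show "generates_self_dual_normal_basis L K q n \<beta> \<longleftrightarrow>
      \<beta> \<in> carrier L \<and> bij_betw (\<lambda>u. act u \<beta>) (carrier A) (carrier L) \<and> form \<beta> \<beta> = \<one>\<^bsub>A\<^esub>"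
    \<comment> \<open>Outside the carrier both conditions fail, because each includes membership in
      \<open>L\<close>.\<close>
    proof (cases "\<beta> \<in> carrier L")
      case True
      then show ?thesis
        unfolding generates_self_dual_normal_basis_def self_dual_iff_form_one[OF True]
          bij_betw_act_iff[OF True] by blast
    qed (simp add: generates_self_dual_normal_basis_def generates_normal_basis_def)
  qed
  show ?thesis
    unfolding sols gens
    using bij_betw_norm_form_solutions[OF finite_K] norm_form_solution_unit[OF finite_K]
    by blast
qed

end
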